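(* Let $R$ and $S$ be linearly ordered rings with $1/2\in R$ and $1/2\in S$, and let $n,m\ge 3$. Then the semigroups $G_n(R)$ and $G_m(S)$ of invertible matrices with nonnegative elements are elementarily equivalent (in the first order language of semigroups) if and only if $n=m$ and the semirings $R_+$ and $S_+$ are elementarily equivalent (in the first order language of semirings).
   Context: A linearly ordered ring $R$ is an associative (not necessarily commutative) ring with $1\neq 0$ with a total order compatible with addition and such that products of positive elements are positive. $R_+$ is the set of all (strictly) positive elements of $R$, regarded as a semiring under the addition and multiplication of $R$. $G_n(R)$ is the subsemigroup of $GL_n(R)$ consisting of all matrices with nonnegative elements (i.e. entries in $R_+\cup\{0\}$; the inverse in $GL_n(R)$ is not required to have nonnegative entries). Two models of the same first order language are elementarily equivalent if every sentence of the language is true in one if and only if it is true in the other. *)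

theory Defs
  imports "Jordan_Normal_Form.Matrix"
begin

(* First-order logic with equality, over languages whose only non-logical symbols are
   binary operation symbols, namely the elements of the type 'f. *)

datatype 'f trm = Var nat | App 'f "'f trm" "'f trm"

datatype 'f fml = Eq "'f trm" "'f trm" | Neg "'f fml" | Conj "'f fml" "'f fml" | All nat "'f fml"

primrec fv_trm :: "'f trm \<Rightarrow> nat set" where
  "fv_trm (Var x) = {x}"
| "fv_trm (App f s t) = fv_trm s \<union> fv_trm t"

primrec fv :: "'f fml \<Rightarrow> nat set" where
  "fv (Eq s t) = fv_trm s \<union> fv_trm t"
| "fv (Neg p) = fv p"
| "fv (Conj p q) = fv p \<union> fv q"
| "fv (All x p) = fv p - {x}"

definition sentence :: "'f fml \<Rightarrow> bool" where
  "sentence p \<longleftrightarrow> fv p = {}"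

(* Only the restriction of oper to universe matters; every structure used below has a
   nonempty universe closed under its operations. *)
record ('f, 'a) op_model =
  universe :: "'a set"
  oper :: "'f \<Rightarrow> 'a \<Rightarrow> 'a \<Rightarrow> 'a"

primrec eval_trm :: "('f, 'a) op_model \<Rightarrow> (nat \<Rightarrow> 'a) \<Rightarrow> 'f trm \<Rightarrow> 'a" where
  "eval_trm M e (Var x) = e x"
| "eval_trm M e (App f s t) = oper M f (eval_trm M e s) (eval_trm M e t)"

primrec sat :: "('f, 'a) op_model \<Rightarrow> (nat \<Rightarrow> 'a) \<Rightarrow> 'f fml \<Rightarrow> bool" where
  "sat M e (Eq s t) \<longleftrightarrow> eval_trm M e s = eval_trm M e t"
| "sat M e (Neg p) \<longleftrightarrow> \<not> sat M e p"
| "sat M e (Conj p q) \<longleftrightarrow> sat M e p \<and> sat M e q"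
| "sat M e (All x p) \<longleftrightarrow> (\<forall>a\<in>universe M. sat M (e(x := a)) p)"

definition true_in :: "('f, 'a) op_model \<Rightarrow> 'f fml \<Rightarrow> bool" where
  "true_in M p \<longleftrightarrow> (\<forall>e. range e \<subseteq> universe M \<longrightarrow> sat M e p)"

definition elementarily_equivalent :: "('f, 'a) op_model \<Rightarrow> ('f, 'b) op_model \<Rightarrow> bool" where
  "elementarily_equivalent M N \<longleftrightarrow> (\<forall>p. sentence p \<longrightarrow> (true_in M p \<longleftrightarrow> true_in N p))"

datatype semigroup_sym = SgMult

datatype semiring_sym = SrAdd | SrMult

(* A linearly ordered associative ring with 1 \<noteq> 0, not necessarily commutative, is a type
   of sort {ring_1, linordered_ring_strict}. *)

definition pos_semiring :: "'a::{ring_1, linordered_ring_strict} itself \<Rightarrow> (semiring_sym, 'a) op_model"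
  where "pos_semiring R =
    \<lparr>universe = {a. 0 < a}, oper = (\<lambda>f. case f of SrAdd \<Rightarrow> (+) | SrMult \<Rightarrow> (*))\<rparr>"

definition nonneg_semigroup ::
    "'a::{ring_1, linordered_ring_strict} itself \<Rightarrow> nat \<Rightarrow> (semigroup_sym, 'a mat) op_model"
  where "nonneg_semigroup R n =
    \<lparr>universe = {A \<in> carrier_mat n n. invertible_mat A \<and> (\<forall>i<n. \<forall>j<n. 0 \<le> A $$ (i, j))},
     oper = (\<lambda>_. (*))\<rparr>"

end

theory Submission
  imports Defs "HOL-Library.Nat_Bijection"
begin

text \<open>Each structure is interpreted in the other by formulas that do not depend on the ring.

  Matrices over \<open>R\<close> are tuples of differences of positive elements, which interprets \<open>G\<^sub>n(R)\<close> in \<open>R\<^sub>+\<close>.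

  Conversely, the units of \<open>G\<^sub>n(R)\<close> commuting with all their conjugates by units form a definable set of
  diagonal matrices, which contains all diagonal matrices with entries 1 and 2. A matrix \<open>X\<close>
  commutes with its conjugates by this set and satisfies \<open>d X = X\<^sup>2 d\<close> for some \<open>d\<close> in it iff
  \<open>X = 1 + N\<close> where \<open>N\<close> has no two composable nonzero entries. Among these, \<open>1 + x E\<^sub>a\<^sub>b\<close>
  with \<open>x > 0\<close> are singled out by the property that all their nontrivial factors have the same
  commutation relations, and the position \<open>(a, b)\<close> is determined by which of them commute. There are
  \<open>n (n - 1)\<close> positions, so \<open>n\<close> is determined; addition in \<open>R\<^sub>+\<close> is the product inside one position,
  and multiplication comes from
  \<open>(1 + x E\<^sub>a\<^sub>b) (1 + y E\<^sub>b\<^sub>c) = (1 + y E\<^sub>b\<^sub>c) (1 + x E\<^sub>a\<^sub>b) (1 + x y E\<^sub>a\<^sub>c)\<close>.\<close>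

section \<open>Definable sets of nonnegative invertible matrices\<close>

lemma one_pos: "(0::'a::{ring_1, linordered_ring_strict}) < 1"
  using zero_le_square[of "1::'a"] by (simp add: less_le)

text \<open>The ring is a domain, so \<open>x * (y * x - 1) = 0\<close> forces
  \<open>y * x = 1\<close>: one-sided inverses are two-sided although multiplication need not
  commute.\<close>

lemma pos_left_inverse_unique:
  fixes x y :: "'a::{ring_1, linordered_ring_strict}"
  assumes "x * y = 1"
  shows "y * x = 1"
proof -
  have "x \<noteq> 0" using assms by auto
  moreover have "x * (y * x - 1) = 0"
    using assms by (simp add: algebra_simps flip: mult.assoc)
  ultimately show ?thesis by simp
qed

lemma pos_inverse:
  fixes x y :: "'a::{ring_1, linordered_ring_strict}"
  assumes "0 < x" "x * y = 1"
  shows "0 < y"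
proof (rule ccontr)
  assume "\<not> 0 < y"
  then have "x * y \<le> 0" using assms by (intro mult_nonneg_nonpos) auto
  then show False using assms one_pos[where 'a='a] by simp
qed

section \<open>Matrix predicates expressible in the semigroup language\<close>

definition nonneg_mats :: "nat \<Rightarrow> 'a::{ring_1, linordered_ring_strict} mat set" where
  "nonneg_mats n =
     {A \<in> carrier_mat n n. invertible_mat A \<and> (\<forall>i<n. \<forall>j<n. 0 \<le> A $$ (i, j))}"

definition inv_pair :: "'a::semiring_0 mat \<Rightarrow> 'a mat \<Rightarrow> bool" where
  "inv_pair g g' \<longleftrightarrow> (g * g') * (g * g') = g * g'"

definition conj_commutes :: "'a::semiring_0 mat \<Rightarrow> 'a mat \<Rightarrow> 'a mat \<Rightarrow> bool" where
  "conj_commutes X d d' \<longleftrightarrow> (X * d) * (X * d') = (d * X) * (d' * X)"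

text \<open>Idempotent elements of the semigroup are trivial, so \<open>inv_pair g g'\<close> says that \<open>g'\<close> is the
  inverse of \<open>g\<close> without naming the identity; likewise \<open>conj_commutes X d d'\<close> says that \<open>X\<close> commutes
  with its conjugate by \<open>d\<close>.\<close>

definition torus :: "nat \<Rightarrow> 'a::{ring_1, linordered_ring_strict} mat \<Rightarrow> bool" where
  "torus n d \<longleftrightarrow> (\<exists>d'\<in>nonneg_mats n. inv_pair d d') \<and>
     (\<forall>g\<in>nonneg_mats n. \<forall>g'\<in>nonneg_mats n. inv_pair g g' \<longrightarrow> conj_commutes d g g')"

text \<open>The first condition, tested on torus elements that double a single index, excludes
  composable nonzero off-diagonal entries. The second says that some torus element conjugates
  \<open>X\<close> to its square, which forces the diagonal entries to be 1.\<close>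

definition quasi_root :: "nat \<Rightarrow> 'a::{ring_1, linordered_ring_strict} mat \<Rightarrow> bool" where
  "quasi_root n X \<longleftrightarrow>
     (\<forall>d\<in>nonneg_mats n. \<forall>d'\<in>nonneg_mats n. torus n d \<and> inv_pair d d' \<longrightarrow> conj_commutes X d d') \<and>
     (\<exists>d\<in>nonneg_mats n. torus n d \<and> d * X = (X * X) * d)"

text \<open>\<open>X * X \<noteq> X\<close> excludes the identity. If \<open>X\<close> has several
  nonzero off-diagonal entries, one of them can be split off as a factor, and the two factors are
  told apart by the matrices commuting with them.\<close>

definition transvection :: "nat \<Rightarrow> 'a::{ring_1, linordered_ring_strict} mat \<Rightarrow> bool" where
  "transvection n X \<longleftrightarrow> quasi_root n X \<and> X * X \<noteq> X \<and>
     (\<forall>Y\<in>nonneg_mats n. \<forall>Z\<in>nonneg_mats n.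
        quasi_root n Y \<and> quasi_root n Z \<and> Y * Y \<noteq> Y \<and> Z * Z \<noteq> Z \<and> X = Y * Z \<longrightarrow>
        (\<forall>W\<in>nonneg_mats n. quasi_root n W \<longrightarrow> (W * Y = Y * W \<longleftrightarrow> W * Z = Z * W)))"

definition same_root :: "nat \<Rightarrow> 'a::{ring_1, linordered_ring_strict} mat \<Rightarrow> 'a mat \<Rightarrow> bool" where
  "same_root n X Y \<longleftrightarrow>
     (\<forall>W\<in>nonneg_mats n. transvection n W \<longrightarrow> (W * X = X * W \<longleftrightarrow> W * Y = Y * W))"

section \<open>Products and inverses of nonnegative matrices\<close>

lemma mult_entry:
  assumes "A \<in> carrier_mat n n" "B \<in> carrier_mat n n" "i < n" "j < n"
  shows "(A * B) $$ (i, j) = (\<Sum>k<n. A $$ (i, k) * B $$ (k, j))"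
  using assms by (auto simp: scalar_prod_def atLeast0LessThan intro!: sum.cong)

lemma mult_carrier_nn [simp]:
  "A \<in> carrier_mat n n \<Longrightarrow> B \<in> carrier_mat n n \<Longrightarrow> A * B \<in> carrier_mat n n"
  by (rule mult_carrier_mat)

lemma mult_assoc_nn:
  "A \<in> carrier_mat n n \<Longrightarrow> B \<in> carrier_mat n n \<Longrightarrow> C \<in> carrier_mat n n \<Longrightarrow>
    (A * B) * C = A * (B * C)"
  by (rule assoc_mult_mat)

lemma mat_eq_iff_entries:
  assumes "A \<in> carrier_mat n n" "B \<in> carrier_mat n n"
  shows "A = B \<longleftrightarrow> (\<forall>i<n. \<forall>j<n. A $$ (i, j) = B $$ (i, j))"
  using assms by (auto intro!: eq_matI)

lemma nonneg_mats_carrier: "A \<in> nonneg_mats n \<Longrightarrow> A \<in> carrier_mat n n"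
  by (simp add: nonneg_mats_def)

lemma nonneg_mats_nonneg: "A \<in> nonneg_mats n \<Longrightarrow> i < n \<Longrightarrow> j < n \<Longrightarrow> 0 \<le> A $$ (i, j)"
  by (simp add: nonneg_mats_def)

lemma invertible_matI:
  assumes "A \<in> carrier_mat n n" "B \<in> carrier_mat n n" "A * B = 1\<^sub>m n" "B * A = 1\<^sub>m n"
  shows "invertible_mat A"
  using assms unfolding invertible_mat_def inverts_mat_def by auto

lemma invertible_matE:
  assumes "invertible_mat A" "A \<in> carrier_mat n n"
  obtains B where "B \<in> carrier_mat n n" "A * B = 1\<^sub>m n" "B * A = 1\<^sub>m n"
proof -
  obtain B where B: "A * B = 1\<^sub>m n" "B * A = 1\<^sub>m (dim_row B)"
    using assms unfolding invertible_mat_def inverts_mat_def by auto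
  have "dim_col B = n" using B(1) by (metis index_mult_mat(3) index_one_mat(3))
  moreover have "dim_row B = n"
    using B(2) assms(2) by (metis carrier_matD(2) index_mult_mat(3) index_one_mat(3))
  ultimately show ?thesis using B that[of B] by auto
qed

lemma nonneg_matsE:
  assumes "A \<in> nonneg_mats n"
  obtains B where "B \<in> carrier_mat n n" "A * B = 1\<^sub>m n" "B * A = 1\<^sub>m n"
  using assms invertible_matE unfolding nonneg_mats_def by blast

lemma nonneg_mats_mult:
  assumes "A \<in> nonneg_mats n" "B \<in> nonneg_mats n"
  shows "A * B \<in> nonneg_mats n"
proof -
  obtain A' where A': "A' \<in> carrier_mat n n" "A * A' = 1\<^sub>m n" "A' * A = 1\<^sub>m n"
    using nonneg_matsE assms by blast
  obtain B' where B': "B' \<in> carrier_mat n n" "B * B' = 1\<^sub>m n" "B' * B = 1\<^sub>m n"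
    using nonneg_matsE assms by blast
  note c = nonneg_mats_carrier[OF assms(1)] nonneg_mats_carrier[OF assms(2)]
  have "B * (B' * A') = A'"
    using c A' B' by (simp flip: mult_assoc_nn)
  then have 1: "(A * B) * (B' * A') = 1\<^sub>m n"
    using c A' B' by (simp add: mult_assoc_nn[of A])
  have "A' * (A * B) = B"
    using c A' B' by (simp flip: mult_assoc_nn)
  then have 2: "(B' * A') * (A * B) = 1\<^sub>m n"
    using c A' B' by (simp add: mult_assoc_nn[of B'])
  have "invertible_mat (A * B)"
    using invertible_matI[OF _ _ 1 2] c A' B' by simp
  moreover have "\<forall>i<n. \<forall>j<n. 0 \<le> (A * B) $$ (i, j)"
    using c assms by (auto simp: mult_entry nonneg_mats_nonneg simp del: index_mult_mat intro!: sum_nonneg)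
  ultimately show ?thesis using c by (simp add: nonneg_mats_def)
qed

lemma mult_left_cancel_inv:
  assumes "A \<in> nonneg_mats n" "X \<in> carrier_mat n n" "Y \<in> carrier_mat n n"
  shows "A * X = A * Y \<longleftrightarrow> X = Y"
proof
  obtain A' where A': "A' \<in> carrier_mat n n" "A' * A = 1\<^sub>m n"
    using nonneg_matsE assms(1) by blast
  assume "A * X = A * Y"
  then have "A' * A * X = A' * A * Y"
    using A'(1) assms nonneg_mats_carrier[OF assms(1)] by (simp add: mult_assoc_nn)
  then show "X = Y" using A' assms by simp
qed simp

lemma nonneg_mats_idem_iff:
  assumes "A \<in> nonneg_mats n"
  shows "A * A = A \<longleftrightarrow> A = 1\<^sub>m n"
  using mult_left_cancel_inv[OF assms, of A "1\<^sub>m n"] nonneg_mats_carrier[OF assms] by simp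

lemma inv_pair_iff:
  assumes "g \<in> nonneg_mats n" "g' \<in> nonneg_mats n"
  shows "inv_pair g g' \<longleftrightarrow> g * g' = 1\<^sub>m n"
  unfolding inv_pair_def using nonneg_mats_idem_iff nonneg_mats_mult assms by blast

text \<open>An off-diagonal entry of the identity is here a sum of nonnegative terms, so each term
  vanishes.\<close>

lemma nonneg_product_diagonal:
  assumes g: "g \<in> nonneg_mats n" and g': "g' \<in> nonneg_mats n" and 1: "g * g' = 1\<^sub>m n"
    and "j < n" "k < n" "l < n" "j \<noteq> l"
  shows "g $$ (j, k) * g' $$ (k, l) = 0"
proof -
  have "(\<Sum>k<n. g $$ (j, k) * g' $$ (k, l)) = 0"
    using mult_entry[OF nonneg_mats_carrier[OF g] nonneg_mats_carrier[OF g'], of j l] 1 assms by simp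
  then show ?thesis
    using assms by (subst (asm) sum_nonneg_eq_0_iff)
      (auto intro!: mult_nonneg_nonneg nonneg_mats_nonneg[of _ n])
qed

section \<open>Diagonal matrices\<close>

definition diagonal :: "nat \<Rightarrow> (nat \<Rightarrow> 'a::zero) \<Rightarrow> 'a mat" where
  "diagonal n u = mat n n (\<lambda>(i, j). if i = j then u i else 0)"

lemma diagonal_carrier [simp]: "diagonal n u \<in> carrier_mat n n"
  by (simp add: diagonal_def)

lemma diagonal_entry [simp]: "i < n \<Longrightarrow> j < n \<Longrightarrow> diagonal n u $$ (i, j) = (if i = j then u i else 0)"
  by (simp add: diagonal_def)

lemma diagonal_mult_left:
  assumes "X \<in> carrier_mat n n" "i < n" "j < n"
  shows "(diagonal n u * X) $$ (i, j) = u i * X $$ (i, j)"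
proof -
  have "(diagonal n u * X) $$ (i, j) = (\<Sum>k<n. if k = i then u i * X $$ (i, j) else 0)"
    unfolding mult_entry[OF diagonal_carrier assms] by (rule sum.cong) (use assms in auto)
  then show ?thesis using assms by simp
qed

lemma diagonal_mult_right:
  assumes "X \<in> carrier_mat n n" "i < n" "j < n"
  shows "(X * diagonal n u) $$ (i, j) = X $$ (i, j) * u j"
proof -
  have "(X * diagonal n u) $$ (i, j) = (\<Sum>k<n. if k = j then X $$ (i, j) * u j else 0)"
    unfolding mult_entry[OF assms(1) diagonal_carrier assms(2-)] by (rule sum.cong) (use assms in auto)
  then show ?thesis using assms by simp
qed

lemma diagonal_mult: "diagonal n u * diagonal n v = diagonal n (\<lambda>i. u i * v i)"
  by (subst mat_eq_iff_entries[of _ n]) (auto simp: diagonal_mult_left simp del: index_mult_mat)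

lemma diagonal_eq_one: "(\<And>i. i < n \<Longrightarrow> u i = 1) \<Longrightarrow> diagonal n u = 1\<^sub>m n"
  by (subst mat_eq_iff_entries[of _ n]) auto

lemma diagonal_nonneg_mats:
  assumes "\<And>i. i < n \<Longrightarrow> u i * v i = 1" "\<And>i. i < n \<Longrightarrow> 0 \<le> u i"
  shows "diagonal n u \<in> nonneg_mats n"
proof -
  have "v i * u i = 1" if "i < n" for i
    using assms pos_left_inverse_unique that by blast
  then have "invertible_mat (diagonal n u)"
    using invertible_matI[of _ n "diagonal n v"] assms by (simp add: diagonal_mult diagonal_eq_one)
  then show ?thesis using assms by (simp add: nonneg_mats_def)
qed

section \<open>Unipotent matrices without composable off-diagonal entries\<close>

text \<open>Writing \<open>X = 1 + N\<close>, no index is both a row index and a column index of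
  nonzero entries of \<open>N\<close>: the support of \<open>N\<close> is a bipartite graph with all
  edges directed the same way. Hence \<open>N D N = 0\<close> for every diagonal matrix
  \<open>D\<close>.\<close>

definition bipartite_unipotent :: "nat \<Rightarrow> 'a::{ring_1, linordered_ring_strict} mat \<Rightarrow> bool" where
  "bipartite_unipotent n X \<longleftrightarrow> X \<in> carrier_mat n n \<and> (\<forall>i<n. X $$ (i, i) = 1) \<and>
     (\<forall>i<n. \<forall>j<n. 0 \<le> X $$ (i, j)) \<and>
     (\<forall>i<n. \<forall>j<n. \<forall>l<n. j \<noteq> i \<longrightarrow> l \<noteq> i \<longrightarrow> X $$ (j, i) * X $$ (i, l) = 0)"

text \<open>These are the entries of \<open>X D X\<close>, where \<open>D\<close> is diagonal with
  entries \<open>c\<close>. Only \<open>k = j\<close> and \<open>k = l\<close> contribute, since any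
  other summand passes through two composable off-diagonal entries.\<close>

lemma bipartite_unipotent_sum:
  assumes X: "bipartite_unipotent n X" and jl: "j < n" "l < n"
  shows "(\<Sum>k<n. X $$ (j, k) * c k * X $$ (k, l)) =
     (if j = l then c j else c j * X $$ (j, l) + X $$ (j, l) * c l)"
proof -
  let ?f = "\<lambda>k. X $$ (j, k) * c k * X $$ (k, l)"
  have "sum ?f {..<n} = sum ?f {j, l}"
  proof (rule sum.mono_neutral_right)
    show "\<forall>k\<in>{..<n} - {j, l}. ?f k = 0"
    proof
      fix k assume "k \<in> {..<n} - {j, l}"
      then have "X $$ (j, k) * X $$ (k, l) = 0" using X jl by (auto simp: bipartite_unipotent_def)
      then show "?f k = 0" by auto
    qed
  qed (use jl in auto)
  also have "\<dots> = (if j = l then c j else c j * X $$ (j, l) + X $$ (j, l) * c l)"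
    using X jl by (auto simp: bipartite_unipotent_def)
  finally show ?thesis .
qed

text \<open>Since \<open>N * N = 0\<close>, the inverse of \<open>1 + N\<close> is
  \<open>1 - N = 2 - X\<close>, the matrix \<open>B\<close> of the proof; its entries may be
  negative.\<close>

lemma bipartite_unipotent_nonneg_mats:
  assumes X: "bipartite_unipotent n X"
  shows "X \<in> nonneg_mats n"
proof -
  have c: "X \<in> carrier_mat n n" using X by (simp add: bipartite_unipotent_def)
  have sq: "(X * X) $$ (j, l) = (if j = l then 1 else X $$ (j, l) + X $$ (j, l))" if "j < n" "l < n" for j l
    using bipartite_unipotent_sum[OF X that, of "\<lambda>_. 1"] c that by (simp add: mult_entry del: index_mult_mat)
  define B where "B = mat n n (\<lambda>(i, j). (if i = j then 1 else 0) + (if i = j then 1 else 0) - X $$ (i, j))"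
  have B: "B \<in> carrier_mat n n" by (simp add: B_def)
  have e: "(X * X) $$ (i, j) = (\<Sum>k<n. X $$ (i, k) * X $$ (k, j))" if "i < n" "j < n" for i j
    using mult_entry[OF c c that] .
  have Bsum: "(\<Sum>k<n. X $$ (i, k) * B $$ (k, j)) = X $$ (i, j) + X $$ (i, j) - (\<Sum>k<n. X $$ (i, k) * X $$ (k, j))"
    "(\<Sum>k<n. B $$ (i, k) * X $$ (k, j)) = X $$ (i, j) + X $$ (i, j) - (\<Sum>k<n. X $$ (i, k) * X $$ (k, j))"
    if "i < n" "j < n" for i j
  proof -
    have "(\<Sum>k<n. X $$ (i, k) * B $$ (k, j)) =
        (\<Sum>k<n. (if k = j then X $$ (i, j) + X $$ (i, j) else 0) - X $$ (i, k) * X $$ (k, j))"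
      using that by (intro sum.cong) (auto simp: B_def algebra_simps)
    then show "(\<Sum>k<n. X $$ (i, k) * B $$ (k, j)) =
        X $$ (i, j) + X $$ (i, j) - (\<Sum>k<n. X $$ (i, k) * X $$ (k, j))"
      using that by (simp add: sum_subtractf)
    have "(\<Sum>k<n. B $$ (i, k) * X $$ (k, j)) =
        (\<Sum>k<n. (if k = i then X $$ (i, j) + X $$ (i, j) else 0) - X $$ (i, k) * X $$ (k, j))"
      using that by (intro sum.cong) (auto simp: B_def algebra_simps)
    then show "(\<Sum>k<n. B $$ (i, k) * X $$ (k, j)) =
        X $$ (i, j) + X $$ (i, j) - (\<Sum>k<n. X $$ (i, k) * X $$ (k, j))"
      using that by (simp add: sum_subtractf)
  qed
  have "(X * B) $$ (i, j) = 1\<^sub>m n $$ (i, j)" "(B * X) $$ (i, j) = 1\<^sub>m n $$ (i, j)"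
    if "i < n" "j < n" for i j
    using sq[OF that] X that Bsum[OF that]
    by (simp_all add: mult_entry[OF c B] mult_entry[OF B c] e bipartite_unipotent_def del: index_mult_mat)
  then have "X * B = 1\<^sub>m n" "B * X = 1\<^sub>m n"
    using c B by (simp_all add: mat_eq_iff_entries[of _ n] del: index_mult_mat)
  then show ?thesis
    using c B X invertible_matI by (auto simp: nonneg_mats_def bipartite_unipotent_def)
qed

lemma conj_left_entry:
  assumes "X \<in> carrier_mat n n" "j < n" "l < n"
  shows "((X * diagonal n u) * (X * diagonal n v)) $$ (j, l) = (\<Sum>k<n. X $$ (j, k) * u k * X $$ (k, l)) * v l"
proof -
  have "((X * diagonal n u) * (X * diagonal n v)) $$ (j, l) =
      (\<Sum>k<n. (X * diagonal n u) $$ (j, k) * (X * diagonal n v) $$ (k, l))"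
    using assms by (intro mult_entry) auto
  also have "\<dots> = (\<Sum>k<n. X $$ (j, k) * u k * X $$ (k, l) * v l)"
    by (rule sum.cong) (use assms in \<open>auto simp: diagonal_mult_right mult.assoc simp del: index_mult_mat\<close>)
  finally show ?thesis by (simp add: sum_distrib_right)
qed

lemma conj_right_entry:
  assumes "X \<in> carrier_mat n n" "j < n" "l < n"
  shows "((diagonal n u * X) * (diagonal n v * X)) $$ (j, l) = u j * (\<Sum>k<n. X $$ (j, k) * v k * X $$ (k, l))"
proof -
  have "((diagonal n u * X) * (diagonal n v * X)) $$ (j, l) =
      (\<Sum>k<n. (diagonal n u * X) $$ (j, k) * (diagonal n v * X) $$ (k, l))"
    using assms by (intro mult_entry) auto
  also have "\<dots> = (\<Sum>k<n. u j * (X $$ (j, k) * v k * X $$ (k, l)))"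
    by (rule sum.cong) (use assms in \<open>auto simp: diagonal_mult_left mult.assoc simp del: index_mult_mat\<close>)
  finally show ?thesis by (simp add: sum_distrib_left)
qed

section \<open>Diagonal matrices with entries 1 and 2, and the torus\<close>

locale half_mats =
  fixes h :: "'a::{ring_1, linordered_ring_strict}" and n :: nat
  assumes half: "2 * h = 1" and n3: "3 \<le> n"
begin

lemma half': "h * 2 = 1"
  using pos_left_inverse_unique[OF half] .

lemma half_pos: "0 < h"
proof (rule ccontr)
  assume "\<not> 0 < h"
  then have "h + h \<le> 0" by (simp add: add_nonpos_nonpos)
  then show False using half one_pos[where 'a='a] by (metis leD mult_2)
qed

lemma two_nonneg: "(0::'a) \<le> 2"
  using add_nonneg_nonneg[of "1::'a" 1] one_pos[where 'a='a] by simp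

lemma half_less_one: "h < 1"
  using half_pos half by (metis less_add_same_cancel1 mult_2)

lemma half_neq_two: "h \<noteq> 2"
proof -
  have "h < 1 + 1" using add_strict_mono[OF half_less_one one_pos[where 'a='a]] one_pos[where 'a='a]
    by (metis add_0_right add_strict_mono half_less_one)
  then show ?thesis by simp
qed

text \<open>The ring may have few units, but these diagonal matrices are invertible as soon as 2 is.
  Since 2 is central, they commute with all diagonal matrices.\<close>

definition doubling :: "nat set \<Rightarrow> 'a mat" where "doubling S = diagonal n (\<lambda>i. if i \<in> S then 2 else 1)"
definition halving :: "nat set \<Rightarrow> 'a mat" where "halving S = diagonal n (\<lambda>i. if i \<in> S then h else 1)"

lemma doubling_mats: "doubling S \<in> nonneg_mats n" "halving S \<in> nonneg_mats n" "inv_pair (doubling S) (halving S)"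
proof -
  show 1: "doubling S \<in> nonneg_mats n"
    unfolding doubling_def
    by (rule diagonal_nonneg_mats[of _ _ "\<lambda>i. if i \<in> S then h else 1"])
      (use two_nonneg one_pos[where 'a='a] in \<open>auto simp: half less_imp_le\<close>)
  show 2: "halving S \<in> nonneg_mats n"
    unfolding halving_def
    by (rule diagonal_nonneg_mats[of _ _ "\<lambda>i. if i \<in> S then 2 else 1"])
      (use half_pos one_pos[where 'a='a] in \<open>auto simp: half' less_imp_le\<close>)
  have "doubling S * halving S = 1\<^sub>m n"
    unfolding doubling_def halving_def diagonal_mult by (rule diagonal_eq_one) (simp add: half)
  then show "inv_pair (doubling S) (halving S)" using inv_pair_iff[OF 1 2] by simp
qed

text \<open>For \<open>j\<close> and \<open>l\<close> other than \<open>i\<close>, the two sides of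
  the relation at \<open>(j, l)\<close> differ only in the summand through \<open>i\<close>, with
  weight 2 on one side and \<open>h\<close> on the other. So
  \<open>X $$ (j, i) * (2 - h) * X $$ (i, l) = 0\<close>, and \<open>2 - h\<close> is
  nonzero.\<close>

lemma conj_commutes_doubling:
  assumes X: "X \<in> carrier_mat n n" and c: "conj_commutes X (doubling {i}) (halving {i})"
    and "i < n" "j < n" "l < n" "j \<noteq> i" "l \<noteq> i"
  shows "X $$ (j, i) * X $$ (i, l) = 0"
proof -
  let ?t = "\<lambda>k. if k \<in> {i} then 2 else 1 :: 'a" and ?s = "\<lambda>k. if k \<in> {i} then h else 1"
  have "(\<Sum>k<n. X $$ (j, k) * ?t k * X $$ (k, l)) = (\<Sum>k<n. X $$ (j, k) * ?s k * X $$ (k, l))"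
    using arg_cong[OF c[unfolded conj_commutes_def doubling_def halving_def], of "\<lambda>A. A $$ (j, l)"] assms
    by (simp add: conj_left_entry conj_right_entry del: index_mult_mat)
  then have "0 = (\<Sum>k<n. X $$ (j, k) * ?t k * X $$ (k, l) - X $$ (j, k) * ?s k * X $$ (k, l))"
    by (simp add: sum_subtractf)
  also have "\<dots> = (\<Sum>k<n. if k = i then X $$ (j, i) * (2 - h) * X $$ (i, l) else 0)"
    by (rule sum.cong) (auto simp: algebra_simps)
  also have "\<dots> = X $$ (j, i) * (2 - h) * X $$ (i, l)" using assms by simp
  finally show ?thesis using half_neq_two by (metis mult_eq_0_iff right_minus_eq)
qed

text \<open>If both \<open>g\<close> and its inverse are nonnegative, every product
  \<open>g $$ (j, k) * g' $$ (k, l)\<close> with \<open>j \<noteq> l\<close> vanishes. So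
  conjugation by \<open>g\<close> sends \<open>doubling S\<close> to a diagonal matrix
  \<open>K\<close>, which commutes with \<open>doubling S\<close> because 1 and 2 are
  central.\<close>

lemma torus_doubling: "torus n (doubling S)"
  unfolding torus_def
proof (intro conjI ballI impI)
  show "\<exists>d'\<in>nonneg_mats n. inv_pair (doubling S) d'" using doubling_mats by blast
  fix g g' :: "'a mat"
  assume g: "g \<in> nonneg_mats n" and g': "g' \<in> nonneg_mats n" and "inv_pair g g'"
  then have 1: "g * g' = 1\<^sub>m n" by (simp add: inv_pair_iff)
  let ?t = "\<lambda>k. if k \<in> S then 2 else 1 :: 'a"
  note c = nonneg_mats_carrier[OF g] nonneg_mats_carrier[OF g']
  have T: "doubling S \<in> carrier_mat n n" by (simp add: doubling_def)
  define K where "K = g * (doubling S * g')"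
  have K: "K \<in> carrier_mat n n" using c T by (simp add: K_def)
  have off: "K $$ (j, l) = 0" if "j < n" "l < n" "j \<noteq> l" for j l
  proof -
    have "g $$ (j, k) * (doubling S * g') $$ (k, l) = 0" if "k < n" for k
    proof -
      have "g $$ (j, k) * ?t k * g' $$ (k, l) = 0"
        using nonneg_product_diagonal[OF g g' 1 \<open>j < n\<close> that \<open>l < n\<close> \<open>j \<noteq> l\<close>] by auto
      then show ?thesis
        using c \<open>l < n\<close> that by (simp add: doubling_def diagonal_mult_left mult.assoc del: index_mult_mat)
    qed
    then show ?thesis
      using mult_entry[OF c(1) mult_carrier_nn[OF T c(2)] that(1,2)] unfolding K_def
      by (simp add: sum.neutral del: index_mult_mat mult_eq_0_iff)
  qed
  have "(doubling S * K) $$ (i, j) = (K * doubling S) $$ (i, j)" if "i < n" "j < n" for i j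
    using K off[OF that] that
    by (cases "i = j") (auto simp: doubling_def diagonal_mult_left diagonal_mult_right mult_2 mult_2_right
        simp del: index_mult_mat)
  then have "doubling S * K = K * doubling S"
    using K T by (simp add: mat_eq_iff_entries[of _ n] del: index_mult_mat)
  then show "conj_commutes (doubling S) g g'"
    using c T unfolding K_def conj_commutes_def by (simp add: mult_assoc_nn)
qed

text \<open>An off-diagonal entry \<open>(j, i)\<close> of a torus element would leave the \<open>i\<close>-th row no other nonzero
  entry than \<open>(i, i)\<close>, which is impossible if the inverse is nonnegative too.\<close>

lemma torus_diagonal:
  fixes d :: "'a mat"
  assumes d: "d \<in> nonneg_mats n" and t: "torus n d"
  obtains u v where "d = diagonal n u" "\<And>i. i < n \<Longrightarrow> 0 < u i" "\<And>i. i < n \<Longrightarrow> u i * v i = 1"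
    "\<And>i x y. i < n \<Longrightarrow> 0 < x \<Longrightarrow> x * y = 1 \<Longrightarrow> u i * x * u i * y = x * u i * y * u i"
proof -
  note c = nonneg_mats_carrier[OF d]
  obtain d' where d': "d' \<in> nonneg_mats n" "inv_pair d d'" using t by (auto simp: torus_def)
  then have 1: "d * d' = 1\<^sub>m n" using d by (simp add: inv_pair_iff)
  have cc: "conj_commutes d g g'" if "g \<in> nonneg_mats n" "g' \<in> nonneg_mats n" "inv_pair g g'" for g g'
    using t that by (auto simp: torus_def)
  have strong: "d $$ (j, i) * d $$ (i, l) = 0" if "i < n" "j < n" "l < n" "j \<noteq> i" "l \<noteq> i" for i j l
    using conj_commutes_doubling[OF c cc[OF doubling_mats] that] .
  have diag_sum: "(\<Sum>k<n. d $$ (i, k) * d' $$ (k, i)) = 1" if "i < n" for i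
    using mult_entry[OF c nonneg_mats_carrier[OF d'(1)] that that] 1 that by simp
  have off: "d $$ (j, i) = 0" if ij: "j < n" "i < n" "j \<noteq> i" for i j
  proof (rule ccontr)
    assume nz: "d $$ (j, i) \<noteq> 0"
    then have "d $$ (i, l) = 0" if "l < n" "l \<noteq> i" for l
      using strong[OF ij(2,1) that(1) ij(3) that(2)] by simp
    then have "(\<Sum>k<n. d $$ (i, k) * d' $$ (k, i)) = (\<Sum>k<n. if k = i then d $$ (i, i) * d' $$ (i, i) else 0)"
      by (intro sum.cong) auto
    then have "d $$ (i, i) * d' $$ (i, i) = 1" using diag_sum[OF ij(2)] ij by simp
    moreover have "d $$ (j, i) * d' $$ (i, i) = 0"
      using nonneg_product_diagonal[OF d d'(1) 1 ij(1,2,2,3)] .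
    ultimately show False using nz by auto
  qed
  define u where "u = (\<lambda>i. d $$ (i, i))"
  have du: "d = diagonal n u" using c off by (subst mat_eq_iff_entries[of _ n]) (auto simp: u_def)
  have uv: "u i * d' $$ (i, i) = 1" if "i < n" for i
    using mult_entry[OF c nonneg_mats_carrier[OF d'(1)] that that]
      diagonal_mult_left[OF nonneg_mats_carrier[OF d'(1)] that that, of u] 1 that du by simp
  have "0 < u i" if "i < n" for i
    using nonneg_mats_nonneg[OF d that that] uv[OF that] by (auto simp: u_def less_le)
  \<comment> \<open>Conjugating by the scalar matrix of a positive unit \<open>x\<close> shows that
    \<open>u i\<close> commutes with its conjugate by \<open>x\<close>. This replaces commutativity
    of the units of the ring.\<close>
  moreover have "u i * x * u i * y = x * u i * y * u i" if "i < n" "0 < x" "x * y = 1" for i x y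
  proof -
    have yx: "y * x = 1" using pos_left_inverse_unique that by blast
    have "0 < y" using pos_inverse that by blast
    then have xy: "diagonal n (\<lambda>_. x) \<in> nonneg_mats n" "diagonal n (\<lambda>_. y) \<in> nonneg_mats n"
      using diagonal_nonneg_mats[of n "\<lambda>_. x" "\<lambda>_. y"] diagonal_nonneg_mats[of n "\<lambda>_. y" "\<lambda>_. x"] that yx
      by (auto simp: less_imp_le)
    then have "inv_pair (diagonal n (\<lambda>_. x)) (diagonal n (\<lambda>_. y))"
      using that by (simp add: inv_pair_iff diagonal_mult diagonal_eq_one)
    from cc[OF xy this] have "diagonal n (\<lambda>i. u i * x * (u i * y)) = diagonal n (\<lambda>i. x * u i * (y * u i))"
      unfolding conj_commutes_def du diagonal_mult by simp
    from arg_cong[OF this, of "\<lambda>A. A $$ (i, i)"] show ?thesis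
      using that by (simp add: mult.assoc)
  qed
  ultimately show ?thesis by (intro that[OF du]) (use uv in auto)
qed

section \<open>Quasi-roots are exactly the bipartite unipotent matrices\<close>

lemma quasi_root_imp_bipartite_unipotent:
  fixes X :: "'a mat"
  assumes X: "X \<in> nonneg_mats n" and q: "quasi_root n X"
  shows "bipartite_unipotent n X"
proof -
  note c = nonneg_mats_carrier[OF X]
  have strong: "X $$ (j, i) * X $$ (i, l) = 0" if "i < n" "j < n" "l < n" "j \<noteq> i" "l \<noteq> i" for i j l
    using conj_commutes_doubling[OF c _ that] q doubling_mats torus_doubling unfolding quasi_root_def by blast
  obtain B where B: "B \<in> carrier_mat n n" "X * B = 1\<^sub>m n" "B * X = 1\<^sub>m n"
    using nonneg_matsE[OF X] .
  obtain d where d: "d \<in> nonneg_mats n" "torus n d" "d * X = (X * X) * d"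
    using q by (auto simp: quasi_root_def)
  obtain u v where du: "d = diagonal n u" and u: "\<And>i. i < n \<Longrightarrow> 0 < u i"
    and uc: "\<And>i x y. i < n \<Longrightarrow> 0 < x \<Longrightarrow> x * y = 1 \<Longrightarrow> u i * x * u i * y = x * u i * y * u i"
    using torus_diagonal[OF d(1,2)] by metis
  have "X $$ (i, i) = 1" if i: "i < n" for i
  proof -
    define x b where "x = X $$ (i, i)" and "b = B $$ (i, i)"
    have sum_i: "(\<Sum>k<n. f k) = f i" if "\<And>k. k < n \<Longrightarrow> k \<noteq> i \<Longrightarrow> f k = 0" for f :: "nat \<Rightarrow> 'a"
      using sum.mono_neutral_right[of "{..<n}" "{i}" f] that i by auto
    \<comment> \<open>Off the diagonal, row \<open>i\<close> or column \<open>i\<close> of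
      \<open>X\<close> vanishes, so the diagonal entry of \<open>X * B\<close> or of
      \<open>B * X\<close> is a single product and \<open>x\<close> is a unit.\<close>
    have "x * b = 1 \<or> b * x = 1"
    proof (cases "\<forall>l<n. l \<noteq> i \<longrightarrow> X $$ (i, l) = 0")
      case True
      then have "(X * B) $$ (i, i) = x * b"
        unfolding mult_entry[OF c B(1) i i] x_def b_def by (intro sum_i) auto
      then show ?thesis using B i by simp
    next
      case False
      then obtain l where "l < n" "l \<noteq> i" "X $$ (i, l) \<noteq> 0" by blast
      then have "X $$ (j, i) = 0" if "j < n" "j \<noteq> i" for j
        using strong[of i j l] i that by auto
      then have "(B * X) $$ (i, i) = b * x"
        unfolding mult_entry[OF B(1) c i i] x_def b_def by (intro sum_i) auto
      then show ?thesis using B i by simp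
    qed
    then have xb: "x * b = 1" "b * x = 1" using pos_left_inverse_unique by blast+
    have x0: "0 < x" using nonneg_mats_nonneg[OF X i i] xb by (auto simp: x_def less_le)
    have "(X * X) $$ (i, i) = x * x"
      unfolding mult_entry[OF c c i i] x_def using strong i by (intro sum_i) auto
    then have "u i * x = x * x * u i"
      using arg_cong[OF d(3), of "\<lambda>A. A $$ (i, i)"] c i
      by (simp add: du diagonal_mult_left diagonal_mult_right x_def del: index_mult_mat)
    \<comment> \<open>Over a commutative ring \<open>u x = x x u\<close> already gives
      \<open>x = 1\<close>. In general, \<open>u\<close> commutes with its conjugate
      \<open>b u x\<close>; substituting \<open>u x = x x u\<close> and \<open>b x = 1\<close> gives
      \<open>u x u = x u u\<close>, hence \<open>x x u u = x u u\<close>, and cancellation yields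
      \<open>x = 1\<close>.\<close>
    moreover have "u i * b * u i * x = b * u i * x * u i"
      using uc[OF i pos_inverse[OF x0 xb(1)] xb(2)] .
    ultimately have "u i * b * (x * x * u i) = b * (x * x * u i) * u i"
      by (simp add: mult.assoc)
    moreover have "u i * b * (x * x * u i) = u i * (b * x) * x * u i"
      "b * (x * x * u i) * u i = (b * x) * x * u i * u i"
      by (simp_all add: mult.assoc)
    ultimately have "u i * x * u i = x * u i * u i" using xb by simp
    then have "x * x * u i * u i = 1 * x * u i * u i" using \<open>u i * x = x * x * u i\<close> by simp
    then have "x = 1" using u[OF i] x0 by (metis less_irrefl mult_right_cancel)
    then show ?thesis by (simp add: x_def)
  qed
  then show ?thesis
    using c X strong by (auto simp: bipartite_unipotent_def nonneg_mats_nonneg)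
qed

text \<open>Products with \<open>X\<close> twice and a diagonal matrix in between are linear in
  \<open>N\<close>, so noncommuting coefficients cause no trouble: at \<open>(j, l)\<close> with
  \<open>j \<noteq> l\<close> both sides of the first condition are
  \<open>u j * X $$ (j, l) * v l + X $$ (j, l)\<close>.\<close>

lemma bipartite_unipotent_imp_quasi_root:
  fixes X :: "'a mat"
  assumes X: "bipartite_unipotent n X"
  shows "quasi_root n X"
  unfolding quasi_root_def
proof (intro conjI ballI impI, elim conjE)
  have c: "X \<in> carrier_mat n n" using X by (simp add: bipartite_unipotent_def)
  {
    fix d d' :: "'a mat"
    assume d: "d \<in> nonneg_mats n" and d': "d' \<in> nonneg_mats n" and t: "torus n d" and i: "inv_pair d d'"
    obtain u v where du: "d = diagonal n u" and uv: "\<And>i. i < n \<Longrightarrow> 0 < u i" "\<And>i. i < n \<Longrightarrow> u i * v i = 1"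
      using torus_diagonal[OF d t] by metis
    have dd: "d * d' = 1\<^sub>m n" using i d d' by (simp add: inv_pair_iff)
    moreover have "d * diagonal n v = 1\<^sub>m n" unfolding du diagonal_mult by (rule diagonal_eq_one) (rule uv)
    ultimately have d'v: "d' = diagonal n v"
      using mult_left_cancel_inv[OF d nonneg_mats_carrier[OF d'], of "diagonal n v"] by simp
    have "((X * d) * (X * d')) $$ (j, l) = ((d * X) * (d' * X)) $$ (j, l)" if jl: "j < n" "l < n" for j l
    proof (cases "j = l")
      case True
      then show ?thesis
        using conj_left_entry[OF c jl, of u v] conj_right_entry[OF c jl, of u v] uv jl True
        by (simp add: du d'v bipartite_unipotent_sum[OF X] del: index_mult_mat)
    next
      case False
      have "(u j * X $$ (j, l) + X $$ (j, l) * u l) * v l = u j * X $$ (j, l) * v l + X $$ (j, l) * (u l * v l)"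
        "u j * (v j * X $$ (j, l) + X $$ (j, l) * v l) = (u j * v j) * X $$ (j, l) + u j * X $$ (j, l) * v l"
        by (simp_all add: algebra_simps)
      with False show ?thesis
        using conj_left_entry[OF c jl, of u v] conj_right_entry[OF c jl, of u v] uv jl
        by (simp add: du d'v bipartite_unipotent_sum[OF X jl] del: index_mult_mat)
    qed
    then show "conj_commutes X d d'"
      using c nonneg_mats_carrier[OF d] nonneg_mats_carrier[OF d'] unfolding conj_commutes_def
      by (subst mat_eq_iff_entries[of _ n]) auto
  }
  \<comment> \<open>\<open>S\<close> consists of the row indices of nonzero entries of
    \<open>N\<close> and contains none of their column indices. So conjugation by
    \<open>doubling S\<close> sends \<open>1 + N\<close> to \<open>1 + 2 N = X * X\<close>.\<close>
  define S where "S = {i. \<exists>l<n. l \<noteq> i \<and> X $$ (i, l) \<noteq> 0}"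
  have "(doubling S * X) $$ (j, l) = ((X * X) * doubling S) $$ (j, l)" if jl: "j < n" "l < n" for j l
  proof -
    have sq: "(X * X) $$ (j, l) = (if j = l then 1 else X $$ (j, l) + X $$ (j, l))"
      using bipartite_unipotent_sum[OF X jl, of "\<lambda>_. 1"] unfolding mult_entry[OF c c jl] by simp
    have "j \<in> S" "l \<notin> S" if "j \<noteq> l" "X $$ (j, l) \<noteq> 0"
    proof -
      show "j \<in> S" using that jl by (auto simp: S_def)
      have "X $$ (l, i) = 0" if "i < n" "i \<noteq> l" for i
      proof -
        have "X $$ (j, l) * X $$ (l, i) = 0"
          using X that jl \<open>j \<noteq> l\<close> unfolding bipartite_unipotent_def by blast
        then show ?thesis using \<open>X $$ (j, l) \<noteq> 0\<close> by simp
      qed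
      then show "l \<notin> S" by (auto simp: S_def)
    qed
    then show ?thesis
      using jl c X sq by (cases "X $$ (j, l) = 0"; cases "j = l")
        (auto simp: doubling_def diagonal_mult_left diagonal_mult_right bipartite_unipotent_def mult_2 simp del: index_mult_mat)
  qed
  then have "doubling S * X = (X * X) * doubling S"
    using c nonneg_mats_carrier[OF doubling_mats(1)] by (subst mat_eq_iff_entries[of _ n]) auto
  then show "\<exists>d\<in>nonneg_mats n. torus n d \<and> d * X = (X * X) * d"
    using doubling_mats torus_doubling by blast
qed

section \<open>Elementary matrices\<close>

definition elem_mat :: "nat \<Rightarrow> nat \<Rightarrow> 'a \<Rightarrow> 'a mat" where
  "elem_mat a b x = mat n n (\<lambda>(i, j). if i = j then 1 else if i = a \<and> j = b then x else 0)"

lemma elem_mat_carrier [simp]: "elem_mat a b x \<in> carrier_mat n n"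
  by (simp add: elem_mat_def)

lemma elem_mat_entry [simp]: "i < n \<Longrightarrow> j < n \<Longrightarrow>
    elem_mat a b x $$ (i, j) = (if i = j then 1 else if i = a \<and> j = b then x else 0)"
  by (simp add: elem_mat_def)

lemma mult_elem_mat:
  assumes "X \<in> carrier_mat n n" "a < n" "b < n" "a \<noteq> b" "i < n" "j < n"
  shows "(X * elem_mat a b x) $$ (i, j) = X $$ (i, j) + (if j = b then X $$ (i, a) * x else 0)"
proof -
  have "(X * elem_mat a b x) $$ (i, j) =
      (\<Sum>k<n. (if k = j then X $$ (i, j) else 0) + (if k = a then (if j = b then X $$ (i, a) * x else 0) else 0))"
    unfolding mult_entry[OF assms(1) elem_mat_carrier assms(5,6)] by (rule sum.cong) (use assms in auto)
  then show ?thesis using assms by (simp add: sum.distrib)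
qed

lemma elem_mat_mult:
  assumes "X \<in> carrier_mat n n" "a < n" "b < n" "a \<noteq> b" "i < n" "j < n"
  shows "(elem_mat a b x * X) $$ (i, j) = X $$ (i, j) + (if i = a then x * X $$ (b, j) else 0)"
proof -
  have "(elem_mat a b x * X) $$ (i, j) =
      (\<Sum>k<n. (if k = i then X $$ (i, j) else 0) + (if k = b then (if i = a then x * X $$ (b, j) else 0) else 0))"
    unfolding mult_entry[OF elem_mat_carrier assms(1) assms(5,6)] by (rule sum.cong) (use assms in auto)
  then show ?thesis using assms by (simp add: sum.distrib)
qed

lemma elem_mat_bipartite_unipotent: "a \<noteq> b \<Longrightarrow> 0 \<le> x \<Longrightarrow> bipartite_unipotent n (elem_mat a b x)"
  using one_pos[where 'a='a] by (auto simp: bipartite_unipotent_def less_imp_le)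

lemma elem_mat_nonneg_mats: "a \<noteq> b \<Longrightarrow> 0 \<le> x \<Longrightarrow> elem_mat a b x \<in> nonneg_mats n"
  using bipartite_unipotent_nonneg_mats elem_mat_bipartite_unipotent by blast

lemma elem_mat_add: "a < n \<Longrightarrow> b < n \<Longrightarrow> a \<noteq> b \<Longrightarrow> elem_mat a b x * elem_mat a b y = elem_mat a b (x + y)"
  by (subst mat_eq_iff_entries[of _ n]) (auto simp: mult_elem_mat add.commute simp del: index_mult_mat)

text \<open>This is the commutator relation of elementary matrices, written without inverses because
  those are not nonnegative in general.\<close>

lemma elem_mat_commutator:
  assumes "a < n" "b < n" "c < n" "a \<noteq> b" "b \<noteq> c" "a \<noteq> c"
  shows "elem_mat a b x * elem_mat b c y = elem_mat b c y * elem_mat a b x * elem_mat a c (x * y)"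
  using assms by (subst mat_eq_iff_entries[of _ n]) (auto simp: mult_elem_mat simp del: index_mult_mat)

lemma elem_mat_inject: "a < n \<Longrightarrow> b < n \<Longrightarrow> a \<noteq> b \<Longrightarrow> elem_mat a b x = elem_mat a b y \<longleftrightarrow> x = y"
  by (subst mat_eq_iff_entries[of _ n]) auto

lemma elem_mat_zero: "elem_mat a b 0 = 1\<^sub>m n"
  by (subst mat_eq_iff_entries[of _ n]) auto

text \<open>Multiplying by the off-diagonal part of \<open>elem_mat a b x\<close> moves column
  \<open>a\<close> of \<open>W\<close> to column \<open>b\<close> on one side, and row
  \<open>b\<close> of \<open>W\<close> to row \<open>a\<close> on the other. The results can meet
  only at \<open>(a, b)\<close>, where both equal \<open>x\<close> as the diagonal of
  \<open>W\<close> is 1.\<close>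

lemma elem_mat_commute_iff:
  assumes W: "bipartite_unipotent n W" and ab: "a < n" "b < n" "a \<noteq> b" and x: "0 < x"
  shows "W * elem_mat a b x = elem_mat a b x * W \<longleftrightarrow>
    (\<forall>i<n. i \<noteq> a \<longrightarrow> W $$ (i, a) = 0) \<and> (\<forall>j<n. j \<noteq> b \<longrightarrow> W $$ (b, j) = 0)" (is "?L \<longleftrightarrow> ?R")
proof -
  have c: "W \<in> carrier_mat n n" and d: "\<And>i. i < n \<Longrightarrow> W $$ (i, i) = 1" using W by (auto simp: bipartite_unipotent_def)
  have L: "?L \<longleftrightarrow> (\<forall>i<n. \<forall>j<n. (if j = b then W $$ (i, a) * x else 0) = (if i = a then x * W $$ (b, j) else 0))"
    using c ab by (subst mat_eq_iff_entries[of _ n]) (auto simp: elem_mat_mult mult_elem_mat simp del: index_mult_mat)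
  show ?thesis
  proof
    assume ?L
    then have e: "(if j = b then W $$ (i, a) * x else 0) = (if i = a then x * W $$ (b, j) else 0)"
      if "i < n" "j < n" for i j using L that by blast
    show ?R using e[OF _ ab(2)] e[OF ab(1)] x by force
  next
    assume ?R
    then show ?L unfolding L using d ab by auto
  qed
qed

text \<open>Here \<open>n \<ge> 3\<close> provides a third index for the test matrices
  below.\<close>

lemma ex_index_not: "\<exists>k<n. k \<noteq> a \<and> k \<noteq> b"
proof -
  have "\<not> {..<n} \<subseteq> {a, b}"
    using n3 card_mono[of "{a, b}" "{..<n}"] by (auto simp: card_insert_if split: if_splits)
  then show ?thesis by auto
qed

section \<open>Transvections are the elementary matrices with a positive entry\<close>

text \<open>Factors with nonnegative entries and diagonal 1 are bounded entrywise by their product.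
  So nontrivial factors of \<open>elem_mat a b x\<close> are again elementary at
  \<open>(a, b)\<close>, and what commutes with them depends only on that position.\<close>

lemma transvection_elem_mat:
  assumes ab: "a < n" "b < n" "a \<noteq> b" and x: "0 < x"
  shows "transvection n (elem_mat a b x)"
  unfolding transvection_def
proof (intro conjI ballI impI)
  let ?X = "elem_mat a b x"
  show "quasi_root n ?X" using ab x elem_mat_bipartite_unipotent bipartite_unipotent_imp_quasi_root by simp
  have X1: "?X \<noteq> 1\<^sub>m n" using elem_mat_inject[OF ab, of x 0] x by (simp add: elem_mat_zero)
  then show "?X * ?X \<noteq> ?X" using nonneg_mats_idem_iff[OF elem_mat_nonneg_mats] ab x by auto
  fix Y Z W :: "'a mat"
  assume "Y \<in> nonneg_mats n" "Z \<in> nonneg_mats n"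
    and "quasi_root n Y \<and> quasi_root n Z \<and> Y * Y \<noteq> Y \<and> Z * Z \<noteq> Z \<and> ?X = Y * Z"
    and W: "W \<in> nonneg_mats n" "quasi_root n W"
  then have Y: "Y \<in> nonneg_mats n" "quasi_root n Y" "Y * Y \<noteq> Y"
    and Z: "Z \<in> nonneg_mats n" "quasi_root n Z" "Z * Z \<noteq> Z" and XYZ: "?X = Y * Z"
    by blast+
  have u: "bipartite_unipotent n Y" "bipartite_unipotent n Z" "bipartite_unipotent n W" using Y Z W quasi_root_imp_bipartite_unipotent by blast+
  have c: "Y \<in> carrier_mat n n" "Z \<in> carrier_mat n n" using u by (auto simp: bipartite_unipotent_def)
  have e: "?X $$ (i, j) = (\<Sum>k<n. Y $$ (i, k) * Z $$ (k, j))" if "i < n" "j < n" for i j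
    using mult_entry[OF c that] XYZ by simp
  have nn: "0 \<le> Y $$ (i, k) * Z $$ (k, j)" if "i < n" "k < n" "j < n" for i j k
    using u that by (auto simp: bipartite_unipotent_def)
  have small: "Y $$ (i, j) \<le> ?X $$ (i, j)" "Z $$ (i, j) \<le> ?X $$ (i, j)" if "i < n" "j < n" for i j
  proof -
    have "Y $$ (i, j) * Z $$ (j, j) \<le> ?X $$ (i, j)" "Y $$ (i, i) * Z $$ (i, j) \<le> ?X $$ (i, j)"
      unfolding e[OF that]
      by (rule member_le_sum[where f = "\<lambda>k. Y $$ (i, k) * Z $$ (k, j)"]; use that nn in auto)+
    then show "Y $$ (i, j) \<le> ?X $$ (i, j)" "Z $$ (i, j) \<le> ?X $$ (i, j)"
      using u that by (auto simp: bipartite_unipotent_def)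
  qed
  have tvY: "\<exists>y>0. Q = elem_mat a b y" if Q: "bipartite_unipotent n Q" "\<And>i j. i < n \<Longrightarrow> j < n \<Longrightarrow> Q $$ (i, j) \<le> ?X $$ (i, j)"
    "Q \<in> nonneg_mats n" "Q * Q \<noteq> Q" for Q
  proof -
    have "Q $$ (i, j) = 0" if "i < n" "j < n" "i \<noteq> j" "\<not> (i = a \<and> j = b)" for i j
      using Q(1) Q(2)[OF that(1,2)] that by (auto simp: bipartite_unipotent_def intro: antisym)
    then have eq: "Q = elem_mat a b (Q $$ (a, b))"
      using Q(1) ab by (subst mat_eq_iff_entries[of _ n]) (auto simp: bipartite_unipotent_def)
    have "Q $$ (a, b) \<noteq> 0" using nonneg_mats_idem_iff[OF Q(3)] Q(4) eq elem_mat_zero by metis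
    then have "0 < Q $$ (a, b)" using Q(1) ab by (auto simp: bipartite_unipotent_def less_le)
    then show ?thesis using eq by blast
  qed
  obtain y z where "y > 0" "Y = elem_mat a b y" "z > 0" "Z = elem_mat a b z"
    using tvY[OF u(1) small(1) Y(1,3)] tvY[OF u(2) small(2) Z(1,3)] by blast
  then show "W * Y = Y * W \<longleftrightarrow> W * Z = Z * W"
    using elem_mat_commute_iff[OF u(3) ab] by simp
qed

text \<open>If \<open>X\<close> had a second nonzero off-diagonal entry, it would be the product of
  its part \<open>Y\<close> at \<open>(a, b)\<close> and the rest \<open>Z\<close>. An elementary
  matrix commuting with \<open>Y\<close> but not with \<open>Z\<close> then contradicts the
  definition.\<close>

lemma transvectionE:
  fixes X :: "'a mat"
  assumes X: "X \<in> nonneg_mats n" and t: "transvection n X"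
  obtains a b x where "a < n" "b < n" "a \<noteq> b" "0 < x" "X = elem_mat a b x"
proof -
  have uX: "bipartite_unipotent n X" using X t quasi_root_imp_bipartite_unipotent by (auto simp: transvection_def)
  then have c: "X \<in> carrier_mat n n" and diag: "\<And>i. i < n \<Longrightarrow> X $$ (i, i) = 1"
    and nn: "\<And>i j. i < n \<Longrightarrow> j < n \<Longrightarrow> 0 \<le> X $$ (i, j)"
    and strong: "\<And>i j l. i < n \<Longrightarrow> j < n \<Longrightarrow> l < n \<Longrightarrow> j \<noteq> i \<Longrightarrow> l \<noteq> i \<Longrightarrow> X $$ (j, i) * X $$ (i, l) = 0"
    by (auto simp: bipartite_unipotent_def)
  have "X \<noteq> 1\<^sub>m n" using t nonneg_mats_idem_iff[OF X] by (auto simp: transvection_def)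
  then obtain a b where ab: "a < n" "b < n" "a \<noteq> b" and Xab: "X $$ (a, b) \<noteq> 0"
    using c diag by (subst (asm) mat_eq_iff_entries[of _ n]) (auto split: if_splits)
  define x Y Z where "x = X $$ (a, b)" and "Y = elem_mat a b x"
    and "Z = mat n n (\<lambda>(i, j). if i = a \<and> j = b then 0 else X $$ (i, j))"
  have x: "0 < x" using nn ab Xab by (auto simp: x_def less_le)
  have "X = elem_mat a b x"
  proof (rule ccontr)
    assume neq: "X \<noteq> elem_mat a b x"
    have Zc: "Z \<in> carrier_mat n n" by (simp add: Z_def)
    have Ze: "Z $$ (i, j) = (if i = a \<and> j = b then 0 else X $$ (i, j))" if "i < n" "j < n" for i j
      using that by (simp add: Z_def)
    have uZ: "bipartite_unipotent n Z"
      using Zc Ze diag nn strong ab by (auto simp: bipartite_unipotent_def)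
    have ZG: "Z \<in> nonneg_mats n" using uZ by (rule bipartite_unipotent_nonneg_mats)
    have YG: "Y \<in> nonneg_mats n" unfolding Y_def using ab x by (simp add: elem_mat_nonneg_mats)
    have XYZ: "X = Y * Z"
    proof -
      have "X $$ (i, j) = Z $$ (i, j) + (if i = a then x * Z $$ (b, j) else 0)" if "i < n" "j < n" for i j
        using Ze[OF that] Ze[OF ab(2) that(2)] strong[of b a j] diag[OF ab(2)] ab that Xab
        by (auto simp: x_def)
      then show ?thesis
        using c Zc ab by (subst mat_eq_iff_entries[of _ n]) (auto simp: Y_def elem_mat_mult simp del: index_mult_mat)
    qed
    have "Z \<noteq> 1\<^sub>m n" using XYZ neq by (auto simp: Y_def right_mult_one_mat[OF elem_mat_carrier])
    then obtain c e where ce: "c < n" "e < n" "c \<noteq> e" and Zce: "Z $$ (c, e) \<noteq> 0"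
      using Zc uZ by (subst (asm) mat_eq_iff_entries[of _ n]) (auto simp: bipartite_unipotent_def split: if_splits)
    have neq2: "\<not> (c = a \<and> e = b)" using Zce Ze ce by auto
    have "quasi_root n Y" "Y * Y \<noteq> Y"
      using transvection_elem_mat[OF ab x] by (auto simp: Y_def transvection_def)
    moreover have "quasi_root n Z" "Z * Z \<noteq> Z"
      using uZ bipartite_unipotent_imp_quasi_root \<open>Z \<noteq> 1\<^sub>m n\<close> nonneg_mats_idem_iff[OF ZG] by auto
    ultimately have "\<forall>W\<in>nonneg_mats n. quasi_root n W \<longrightarrow> (W * Y = Y * W \<longleftrightarrow> W * Z = Z * W)"
      using t YG ZG XYZ unfolding transvection_def by blast
    then have iff: "W * Y = Y * W \<longleftrightarrow> W * Z = Z * W" if "bipartite_unipotent n W" for W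
      using that bipartite_unipotent_imp_quasi_root bipartite_unipotent_nonneg_mats by blast
    show False
    proof (cases "e = b")
      case False
      \<comment> \<open>\<open>W\<close> composes with the entry of \<open>Z\<close> at
        \<open>(c, e)\<close> on its right, while \<open>e \<noteq> b\<close> and
        \<open>k \<noteq> a\<close> keep it from composing with \<open>Y\<close>.\<close>
      obtain k where k: "k < n" "k \<noteq> e" "k \<noteq> a" using ex_index_not by blast
      define W where "W = elem_mat e k 1"
      have uW: "bipartite_unipotent n W" unfolding W_def using k one_pos[where 'a='a] by (intro elem_mat_bipartite_unipotent) (auto simp: less_imp_le)
      have "W * Y = Y * W"
        unfolding Y_def elem_mat_commute_iff[OF uW ab x] unfolding W_def using ab ce k False by auto
      moreover have "Z * W \<noteq> W * Z"
        unfolding W_def using elem_mat_commute_iff[OF uZ, of e k 1] ce k Zce one_pos[where 'a='a] by auto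
      ultimately show False using iff[OF uW] by auto
    next
      case True
      then have "c \<noteq> a" using neq2 by simp
      \<comment> \<open>Dually, \<open>W\<close> composes with the entry of \<open>Z\<close> at
        \<open>(c, e)\<close> on its left, and \<open>c \<noteq> a\<close>,
        \<open>k \<noteq> b\<close> keep it from composing with \<open>Y\<close>.\<close>
      obtain k where k: "k < n" "k \<noteq> c" "k \<noteq> b" using ex_index_not by blast
      define W where "W = elem_mat k c 1"
      have uW: "bipartite_unipotent n W" unfolding W_def using k one_pos[where 'a='a] by (intro elem_mat_bipartite_unipotent) (auto simp: less_imp_le)
      have "W * Y = Y * W"
        unfolding Y_def elem_mat_commute_iff[OF uW ab x] unfolding W_def using ab ce k \<open>c \<noteq> a\<close> True by auto
      moreover have "Z * W \<noteq> W * Z"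
        unfolding W_def using elem_mat_commute_iff[OF uZ, of k c 1] ce k Zce one_pos[where 'a='a] by auto
      ultimately show False using iff[OF uW] by auto
    qed
  qed
  then show ?thesis using that ab x by blast
qed

section \<open>Positions of transvections and how they compose\<close>

lemma elem_mat_elem_mat_commute:
  assumes "a < n" "b < n" "a \<noteq> b" "0 < x" "c < n" "d < n" "c \<noteq> d" "0 < y"
  shows "elem_mat c d y * elem_mat a b x = elem_mat a b x * elem_mat c d y \<longleftrightarrow> d \<noteq> a \<and> c \<noteq> b"
proof -
  have "bipartite_unipotent n (elem_mat c d y)" using assms by (intro elem_mat_bipartite_unipotent) auto
  from elem_mat_commute_iff[OF this assms(1-4)] show ?thesis using assms by auto
qed

lemma same_root_elem_mat_iff:
  assumes ab: "a < n" "b < n" "a \<noteq> b" "0 < x" and cd: "c < n" "d < n" "c \<noteq> d" "0 < y"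
  shows "same_root n (elem_mat a b x) (elem_mat c d y) \<longleftrightarrow> a = c \<and> b = d"
proof
  assume same: "same_root n (elem_mat a b x) (elem_mat c d y)"
  have *: "f \<noteq> a \<and> e \<noteq> b \<longleftrightarrow> f \<noteq> c \<and> e \<noteq> d" if ef: "e < n" "f < n" "e \<noteq> f" for e f
  proof -
    have "elem_mat e f 1 \<in> nonneg_mats n" "transvection n (elem_mat e f 1)"
      using ef one_pos[where 'a='a] by (auto intro!: elem_mat_nonneg_mats transvection_elem_mat simp: less_imp_le)
    then have "elem_mat e f 1 * elem_mat a b x = elem_mat a b x * elem_mat e f 1 \<longleftrightarrow> elem_mat e f 1 * elem_mat c d y = elem_mat c d y * elem_mat e f 1"
      using same by (simp add: same_root_def)
    then show ?thesis
      using elem_mat_elem_mat_commute[OF ab ef one_pos] elem_mat_elem_mat_commute[OF cd ef one_pos] by simp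
  qed
  \<comment> \<open>The elementary matrix at \<open>(b, k)\<close> fails to commute with the first
    matrix; as \<open>k \<noteq> c\<close>, its failure with the second can only come from
    \<open>b = d\<close>. The matrix at \<open>(k, a)\<close> gives \<open>a = c\<close> in the same
    way.\<close>
  obtain k where "k < n" "k \<noteq> b" "k \<noteq> c" using ex_index_not by blast
  with *[of b k] ab have "b = d" by auto
  moreover obtain k where "k < n" "k \<noteq> a" "k \<noteq> d" using ex_index_not by blast
  with *[of k a] ab have "a = c" by auto
  ultimately show "a = c \<and> b = d" by simp
next
  assume "a = c \<and> b = d"
  then show "same_root n (elem_mat a b x) (elem_mat c d y)"
    unfolding same_root_def
    using elem_mat_elem_mat_commute[OF ab] elem_mat_elem_mat_commute[OF cd] by (auto elim!: transvectionE)
qed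

text \<open>The order of the factors matters. If \<open>d = a\<close>, the product
  \<open>Y X\<close> has an extra \<open>y * x\<close> at \<open>(c, b)\<close>, and multiplying by
  the nonnegative \<open>Z\<close> cannot remove it. If neither \<open>d = a\<close> nor
  \<open>c = b\<close>, the factors commute and \<open>Z\<close> would be the identity, which is no
  transvection.\<close>

lemma elem_mat_product_iff:
  assumes ab: "a < n" "b < n" "a \<noteq> b" "0 < x" and cd: "c < n" "d < n" "c \<noteq> d" "0 < y"
    and Z: "Z \<in> nonneg_mats n"
  shows "transvection n Z \<and> elem_mat a b x * elem_mat c d y = elem_mat c d y * elem_mat a b x * Z \<longleftrightarrow>
    c = b \<and> d \<noteq> a \<and> Z = elem_mat a d (x * y)" (is "?L \<longleftrightarrow> ?R")
proof
  assume ?R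
  then show ?L
    using elem_mat_commutator[of a b d x y] transvection_elem_mat[of a d "x * y"] ab cd by auto
next
  assume L: ?L
  let ?X = "elem_mat a b x" and ?Y = "elem_mat c d y"
  have XG: "?X \<in> nonneg_mats n" and YG: "?Y \<in> nonneg_mats n" using ab cd by (auto intro: elem_mat_nonneg_mats)
  then have YX: "?Y * ?X \<in> nonneg_mats n" by (rule nonneg_mats_mult[rotated])
  obtain e f z where ef: "e < n" "f < n" "e \<noteq> f" "0 < z" and Zt: "Z = elem_mat e f z"
    using transvectionE[OF Z] L by metis
  have "d \<noteq> a"
  proof
    assume da: "d = a"
    have "(?Y * ?X * Z) $$ (c, b) = (?X * ?Y) $$ (c, b)" using L by simp
    moreover have "(?Y * ?X * Z) $$ (c, b) = (?Y * ?X) $$ (c, b) + (if b = f then (?Y * ?X) $$ (c, e) * z else 0)"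
      unfolding Zt using mult_elem_mat[OF nonneg_mats_carrier[OF YX] ef(1-3) cd(1) ab(2)] .
    moreover have "0 \<le> (if b = f then (?Y * ?X) $$ (c, e) * z else 0)"
      using mult_nonneg_nonneg[OF nonneg_mats_nonneg[OF YX cd(1) ef(1)], of z] ef(4)
      by (metis less_imp_le order_refl)
    ultimately have "(?Y * ?X) $$ (c, b) \<le> (?X * ?Y) $$ (c, b)"
      by (metis le_add_same_cancel1)
    moreover have "(?Y * ?X) $$ (c, b) = (if c = b then 1 else 0) + y * x"
      using ab cd da by (subst elem_mat_mult) auto
    moreover have "(?X * ?Y) $$ (c, b) = (if c = b then 1 else 0)"
      using ab cd da by (subst mult_elem_mat) auto
    moreover have "0 < y * x" using ab cd by simp
    ultimately show False by (auto split: if_splits)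
  qed
  moreover have "c = b"
  proof (rule ccontr)
    assume "c \<noteq> b"
    then have "?X * ?Y = ?Y * ?X" using elem_mat_elem_mat_commute[OF ab cd] \<open>d \<noteq> a\<close> by simp
    then have "?Y * ?X * Z = ?Y * ?X * 1\<^sub>m n" using L right_mult_one_mat[OF nonneg_mats_carrier[OF YX]] by simp
    then have "Z = 1\<^sub>m n" using mult_left_cancel_inv[OF YX] nonneg_mats_carrier[OF Z] by simp
    then show False using L nonneg_mats_idem_iff[OF Z] by (simp add: transvection_def)
  qed
  moreover have "?Y * ?X * Z = ?Y * ?X * elem_mat a d (x * y)"
    using L elem_mat_commutator[of a b d x y] ab cd calculation by simp
  then have "Z = elem_mat a d (x * y)"
    using mult_left_cancel_inv[OF YX] nonneg_mats_carrier[OF Z] by simp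
  ultimately show ?R by blast
qed

end

section \<open>Coordinates of positive elements relative to two transvections\<close>

definition product_root :: "nat \<Rightarrow> 'a::{ring_1, linordered_ring_strict} mat \<Rightarrow> 'a mat \<Rightarrow> 'a mat \<Rightarrow> bool" where
  "product_root n X Y Z \<longleftrightarrow> transvection n Z \<and> X * Y = (Y * X) * Z"

text \<open>For \<open>P = elem_mat a b p\<close> and \<open>Q = elem_mat b c q\<close> with
  \<open>a \<noteq> c\<close>, the domain consists of all transvections at position
  \<open>(a, c)\<close>.\<close>

definition coord_dom :: "nat \<Rightarrow> 'a::{ring_1, linordered_ring_strict} mat \<Rightarrow> 'a mat \<Rightarrow> 'a mat \<Rightarrow> bool" where
  "coord_dom n P Q C \<longleftrightarrow> transvection n C \<and>
     (\<exists>Z\<in>nonneg_mats n. product_root n P Q Z \<and> same_root n C Z)"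

text \<open>\<open>coord_left\<close> and \<open>coord_right\<close> move a coordinate
  \<open>r\<close> from \<open>(a, c)\<close> to \<open>(a, b)\<close> and \<open>(b, c)\<close>,
  dividing it by \<open>q\<close> on the right and by \<open>p\<close> on the left. At these
  composable positions two coordinates can be multiplied.\<close>

definition coord_left :: "nat \<Rightarrow> 'a::{ring_1, linordered_ring_strict} mat \<Rightarrow> 'a mat \<Rightarrow> 'a mat \<Rightarrow> 'a mat \<Rightarrow> bool" where
  "coord_left n P Q C X \<longleftrightarrow> transvection n X \<and> same_root n X P \<and> product_root n X Q C"

definition coord_right :: "nat \<Rightarrow> 'a::{ring_1, linordered_ring_strict} mat \<Rightarrow> 'a mat \<Rightarrow> 'a mat \<Rightarrow> 'a mat \<Rightarrow> bool" where
  "coord_right n P Q C Y \<longleftrightarrow> transvection n Y \<and> same_root n Y Q \<and> product_root n P Y C"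

definition coord_frame :: "nat \<Rightarrow> 'a::{ring_1, linordered_ring_strict} mat \<Rightarrow> 'a mat \<Rightarrow> bool" where
  "coord_frame n P Q \<longleftrightarrow> transvection n P \<and> transvection n Q \<and>
     (\<exists>Z\<in>nonneg_mats n. product_root n P Q Z) \<and>
     (\<forall>C\<in>nonneg_mats n. coord_dom n P Q C \<longrightarrow>
        (\<exists>X\<in>nonneg_mats n. coord_left n P Q C X) \<and> (\<exists>Y\<in>nonneg_mats n. coord_right n P Q C Y))"

definition coord_mult ::
    "nat \<Rightarrow> 'a::{ring_1, linordered_ring_strict} mat \<Rightarrow> 'a mat \<Rightarrow> 'a mat \<Rightarrow> 'a mat \<Rightarrow> 'a mat \<Rightarrow> bool" where
  "coord_mult n P Q A B C \<longleftrightarrow>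
     (\<exists>X\<in>nonneg_mats n. \<exists>Y\<in>nonneg_mats n.
        coord_left n P Q A X \<and> coord_right n P Q B Y \<and> product_root n X Y C)"

context half_mats
begin

lemma product_root_elem_mat_iff:
  assumes "a < n" "b < n" "a \<noteq> b" "0 < x" "c < n" "d < n" "c \<noteq> d" "0 < y" "Z \<in> nonneg_mats n"
  shows "product_root n (elem_mat a b x) (elem_mat c d y) Z \<longleftrightarrow> c = b \<and> d \<noteq> a \<and> Z = elem_mat a d (x * y)"
  using elem_mat_product_iff[OF assms] by (simp add: product_root_def)

context
  fixes a b c :: nat and p q :: 'a
  assumes abc: "a < n" "b < n" "c < n" "a \<noteq> b" "b \<noteq> c" "a \<noteq> c" and pq: "0 < p" "0 < q"
begin

lemma elem_mat_ac_mats: "0 < x \<Longrightarrow> elem_mat a c x \<in> nonneg_mats n"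
  using abc by (auto intro!: elem_mat_nonneg_mats)

lemma coord_dom_elem_mat_iff:
  assumes "C \<in> nonneg_mats n"
  shows "coord_dom n (elem_mat a b p) (elem_mat b c q) C \<longleftrightarrow> (\<exists>r>0. C = elem_mat a c r)"
proof -
  have pr: "product_root n (elem_mat a b p) (elem_mat b c q) Z \<longleftrightarrow> Z = elem_mat a c (p * q)" if "Z \<in> nonneg_mats n" for Z
    using product_root_elem_mat_iff[OF abc(1,2,4) pq(1) abc(2,3,5) pq(2) that] abc by simp
  show ?thesis
  proof
    assume "coord_dom n (elem_mat a b p) (elem_mat b c q) C"
    then have "transvection n C" "same_root n C (elem_mat a c (p * q))"
      using pr by (auto simp: coord_dom_def)
    with transvectionE[OF assms] same_root_elem_mat_iff[OF _ _ _ _ abc(1,3,6)] pq mult_pos_pos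
    show "\<exists>r>0. C = elem_mat a c r" by metis
  next
    assume "\<exists>r>0. C = elem_mat a c r"
    then obtain r where r: "0 < r" "C = elem_mat a c r" by blast
    have "same_root n C (elem_mat a c (p * q))"
      using same_root_elem_mat_iff[OF abc(1,3,6) r(1) abc(1,3,6), of "p * q"] pq r(2) by simp
    moreover have "transvection n C" using transvection_elem_mat abc r by simp
    ultimately show "coord_dom n (elem_mat a b p) (elem_mat b c q) C"
      using pr[OF elem_mat_ac_mats, of "p * q"] elem_mat_ac_mats[of "p * q"] pq by (auto simp: coord_dom_def)
  qed
qed

lemma coord_left_elem_mat_iff:
  assumes "X \<in> nonneg_mats n" "0 < r"
  shows "coord_left n (elem_mat a b p) (elem_mat b c q) (elem_mat a c r) X \<longleftrightarrow> (\<exists>x>0. x * q = r \<and> X = elem_mat a b x)"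
proof
  assume L: "coord_left n (elem_mat a b p) (elem_mat b c q) (elem_mat a c r) X"
  then obtain x where x: "0 < x" "X = elem_mat a b x"
    using transvectionE[OF assms(1)] same_root_elem_mat_iff[OF _ _ _ _ abc(1,2,4) pq(1)]
    unfolding coord_left_def by metis
  then have "elem_mat a c r = elem_mat a c (x * q)"
    using L product_root_elem_mat_iff[OF abc(1,2,4) x(1) abc(2,3,5) pq(2) elem_mat_ac_mats[OF assms(2)]]
    by (simp add: coord_left_def)
  then show "\<exists>x>0. x * q = r \<and> X = elem_mat a b x" using x elem_mat_inject[OF abc(1,3,6)] by auto
next
  assume "\<exists>x>0. x * q = r \<and> X = elem_mat a b x"
  then show "coord_left n (elem_mat a b p) (elem_mat b c q) (elem_mat a c r) X"
    using product_root_elem_mat_iff[OF abc(1,2,4) _ abc(2,3,5) pq(2) elem_mat_ac_mats[OF assms(2)]] abc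
      same_root_elem_mat_iff[OF abc(1,2,4) _ abc(1,2,4) pq(1)] transvection_elem_mat[OF abc(1,2,4)]
    by (auto simp: coord_left_def)
qed

lemma coord_right_elem_mat_iff:
  assumes "Y \<in> nonneg_mats n" "0 < r"
  shows "coord_right n (elem_mat a b p) (elem_mat b c q) (elem_mat a c r) Y \<longleftrightarrow> (\<exists>y>0. p * y = r \<and> Y = elem_mat b c y)"
proof
  assume L: "coord_right n (elem_mat a b p) (elem_mat b c q) (elem_mat a c r) Y"
  then obtain y where y: "0 < y" "Y = elem_mat b c y"
    using transvectionE[OF assms(1)] same_root_elem_mat_iff[OF _ _ _ _ abc(2,3,5) pq(2)]
    unfolding coord_right_def by metis
  then have "elem_mat a c r = elem_mat a c (p * y)"
    using L product_root_elem_mat_iff[OF abc(1,2,4) pq(1) abc(2,3,5) y(1) elem_mat_ac_mats[OF assms(2)]]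
    by (simp add: coord_right_def)
  then show "\<exists>y>0. p * y = r \<and> Y = elem_mat b c y" using y elem_mat_inject[OF abc(1,3,6)] by auto
next
  assume "\<exists>y>0. p * y = r \<and> Y = elem_mat b c y"
  then show "coord_right n (elem_mat a b p) (elem_mat b c q) (elem_mat a c r) Y"
    using product_root_elem_mat_iff[OF abc(1,2,4) pq(1) abc(2,3,5) _ elem_mat_ac_mats[OF assms(2)]] abc
      same_root_elem_mat_iff[OF abc(2,3,5) _ abc(2,3,5) pq(2)] transvection_elem_mat[OF abc(2,3,5)]
    by (auto simp: coord_right_def)
qed

lemma coord_mult_elem_mat_iff:
  assumes "C \<in> nonneg_mats n" "0 < r" "0 < s"
  shows "coord_mult n (elem_mat a b p) (elem_mat b c q) (elem_mat a c r) (elem_mat a c s) C \<longleftrightarrow>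
     (\<exists>x>0. \<exists>y>0. x * q = r \<and> p * y = s \<and> C = elem_mat a c (x * y))"
proof -
  have *: "elem_mat a b x \<in> nonneg_mats n" "elem_mat b c x \<in> nonneg_mats n" if "0 < x" for x
    using that abc by (auto intro!: elem_mat_nonneg_mats)
  have **: "product_root n (elem_mat a b x) (elem_mat b c y) C \<longleftrightarrow> C = elem_mat a c (x * y)" if "0 < x" "0 < y" for x y
    using product_root_elem_mat_iff[OF abc(1,2,4) that(1) abc(2,3,5) that(2) assms(1)] abc by simp
  show ?thesis
    unfolding coord_mult_def
    using coord_left_elem_mat_iff[OF _ assms(2)] coord_right_elem_mat_iff[OF _ assms(3)] * **
    by (smt (verit, best))
qed

end

text \<open>If \<open>P = 1 + p E\<^sub>a\<^sub>b\<close> and \<open>Q = 1 + q E\<^sub>b\<^sub>c\<close>, surjectivity in \<^const>\<open>coord_frame\<close> makes \<open>p\<close> and \<open>q\<close> units,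
  and the multiplication read off on \<open>1 + r E\<^sub>a\<^sub>c\<close> is the twisted one \<open>r (p q)\<^sup>-\<^sup>1 s\<close>, for which
  \<open>r \<mapsto> r p q\<close> is an isomorphism.\<close>

lemma coord_frameE:
  fixes P Q :: "'a mat"
  assumes PQ: "P \<in> nonneg_mats n" "Q \<in> nonneg_mats n" and f: "coord_frame n P Q"
  obtains \<iota> :: "'a \<Rightarrow> 'a mat" where
    "\<And>r. 0 < r \<Longrightarrow> \<iota> r \<in> nonneg_mats n"
    "\<And>r s. 0 < r \<Longrightarrow> 0 < s \<Longrightarrow> \<iota> r = \<iota> s \<Longrightarrow> r = s"
    "\<And>C. C \<in> nonneg_mats n \<Longrightarrow> coord_dom n P Q C \<longleftrightarrow> (\<exists>r>0. C = \<iota> r)"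
    "\<And>r s. 0 < r \<Longrightarrow> 0 < s \<Longrightarrow> \<iota> r * \<iota> s = \<iota> (r + s)"
    "\<And>r s C. 0 < r \<Longrightarrow> 0 < s \<Longrightarrow> C \<in> nonneg_mats n \<Longrightarrow>
      coord_mult n P Q (\<iota> r) (\<iota> s) C \<longleftrightarrow> C = \<iota> (r * s)"
proof -
  obtain a b p where P: "a < n" "b < n" "a \<noteq> b" "0 < p" "P = elem_mat a b p"
    using f transvectionE[OF PQ(1)] unfolding coord_frame_def by metis
  obtain b' c q where Q: "b' < n" "c < n" "b' \<noteq> c" "0 < q" "Q = elem_mat b' c q"
    using f transvectionE[OF PQ(2)] unfolding coord_frame_def by metis
  have "b' = b" "c \<noteq> a"
    using f product_root_elem_mat_iff[OF P(1-4) Q(1-4)] unfolding coord_frame_def P(5) Q(5) by blast+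
  then have abc: "a < n" "b < n" "c < n" "a \<noteq> b" "b \<noteq> c" "a \<noteq> c" using P Q by auto
  have Qe: "Q = elem_mat b c q" using Q \<open>b' = b\<close> by simp
  note pq = P(4) Q(4)
  note dom = coord_dom_elem_mat_iff[OF abc pq, folded P(5) Qe]
  note left = coord_left_elem_mat_iff[OF abc pq, folded P(5) Qe]
  note right = coord_right_elem_mat_iff[OF abc pq, folded P(5) Qe]
  note mult = coord_mult_elem_mat_iff[OF abc pq, folded P(5) Qe]
  have mats: "elem_mat a c r \<in> nonneg_mats n" if "0 < r" for r
    using elem_mat_ac_mats[OF abc pq that] .
  have "coord_dom n P Q (elem_mat a c 1)" using dom[OF mats[OF one_pos]] one_pos by blast
  \<comment> \<open>Moving the coordinate 1 to the two other positions yields a left inverse of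
    \<open>q\<close> and a right inverse of \<open>p\<close>.\<close>
  then obtain q' p' where q': "q' * q = 1" and p': "p * p' = 1"
    using f left[OF _ one_pos] right[OF _ one_pos] mats[OF one_pos] unfolding coord_frame_def by blast
  have qq: "q * q' = 1" and pp: "p' * p = 1" using q' p' pos_left_inverse_unique by blast+
  have pos: "0 < p'" "0 < q'" using pos_inverse[OF pq(1) p'] pos_inverse[OF pq(2) qq] .
  define \<iota> where "\<iota> r = elem_mat a c (r * (p * q))" for r
  show ?thesis
  proof (rule that[of \<iota>])
    fix r s :: 'a assume r: "0 < r"
    show "\<iota> r \<in> nonneg_mats n" using mats r pq by (simp add: \<iota>_def)
    assume s: "0 < s"
    show "r = s" if "\<iota> r = \<iota> s"
      using that elem_mat_inject[OF abc(1,3,6)] pq by (auto simp: \<iota>_def)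
    show "\<iota> r * \<iota> s = \<iota> (r + s)"
      using elem_mat_add[OF abc(1,3,6)] by (simp add: \<iota>_def distrib_right)
    fix C :: "'a mat" assume C: "C \<in> nonneg_mats n"
    have w: "0 < r * (p * q)" "0 < s * (p * q)" using r s pq by auto
    have *: "x * q = r * (p * q) \<longleftrightarrow> x = r * p" for x
      using pq by (auto simp flip: mult.assoc)
    have **: "p * y = s * (p * q) \<longleftrightarrow> y = p' * s * p * q" for y
    proof
      assume "p * y = s * (p * q)"
      then have "p' * (p * y) = p' * (s * (p * q))" by simp
      then show "y = p' * s * p * q" using pp by (simp flip: mult.assoc)
    qed (use p' in \<open>simp flip: mult.assoc\<close>)
    have "r * p * (p' * s * p * q) = r * (p * p') * s * (p * q)" by (simp add: mult.assoc)
    then have e: "r * p * (p' * s * p * q) = r * s * (p * q)" using p' by simp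
    show "coord_mult n P Q (\<iota> r) (\<iota> s) C \<longleftrightarrow> C = \<iota> (r * s)"
      unfolding \<iota>_def mult[OF C w] * ** using r s pq pos e by auto
  next
    fix C :: "'a mat" assume C: "C \<in> nonneg_mats n"
    have "(\<exists>r>0. C = elem_mat a c r) \<longleftrightarrow> (\<exists>r>0. C = \<iota> r)"
    proof
      assume "\<exists>r>0. C = elem_mat a c r"
      then obtain r where "0 < r" "C = elem_mat a c r" by blast
      moreover have "r * q' * p' * (p * q) = r * (q' * (p' * p) * q)" by (simp add: mult.assoc)
      ultimately have "C = \<iota> (r * q' * p')" "0 < r * q' * p'"
        using pp q' pos by (simp_all add: \<iota>_def)
      then show "\<exists>r>0. C = \<iota> r" by blast
    next
      assume "\<exists>r>0. C = \<iota> r"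
      then obtain r where "0 < r" "C = elem_mat a c (r * (p * q))" by (auto simp: \<iota>_def)
      then show "\<exists>r>0. C = elem_mat a c r" using pq mult_pos_pos by blast
    qed
    then show "coord_dom n P Q C \<longleftrightarrow> (\<exists>r>0. C = \<iota> r)" using dom[OF C] by simp
  qed
qed

text \<open>With \<open>p = q = 1\<close> every coordinate can be moved unchanged. Without a frame,
  statements about all frames would hold vacuously.\<close>

lemma ex_coord_frame: "\<exists>P\<in>nonneg_mats n. \<exists>Q\<in>nonneg_mats n. coord_frame n P (Q :: 'a mat)"
proof -
  let ?P = "elem_mat 0 1 1" and ?Q = "elem_mat 1 2 1"
  have abc: "0 < n" "1 < n" "2 < n" "0 \<noteq> (1::nat)" "1 \<noteq> (2::nat)" "0 \<noteq> (2::nat)" using n3 by auto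
  note one = one_pos[where 'a='a]
  have mats: "elem_mat 0 1 r \<in> nonneg_mats n" "elem_mat 1 2 r \<in> nonneg_mats n" "elem_mat 0 2 r \<in> nonneg_mats n"
    if "0 < r" for r using that by (auto intro!: elem_mat_nonneg_mats)
  have "product_root n ?P ?Q (elem_mat 0 2 1)"
    using product_root_elem_mat_iff[OF abc(1,2,4) one abc(2,3,5) one mats(3)[OF one]] by simp
  moreover have "(\<exists>X\<in>nonneg_mats n. coord_left n ?P ?Q C X) \<and> (\<exists>Y\<in>nonneg_mats n. coord_right n ?P ?Q C Y)"
    if C: "C \<in> nonneg_mats n" "coord_dom n ?P ?Q C" for C
  proof -
    obtain r where r: "0 < r" "C = elem_mat 0 2 r"
      using C coord_dom_elem_mat_iff[OF abc one one C(1)] by blast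
    have "coord_left n ?P ?Q C (elem_mat 0 1 r)" "coord_right n ?P ?Q C (elem_mat 1 2 r)"
      using coord_left_elem_mat_iff[OF abc one one mats(1)[OF r(1)] r(1)]
        coord_right_elem_mat_iff[OF abc one one mats(2)[OF r(1)] r(1)] r by auto
    then show ?thesis using mats r(1) by blast
  qed
  ultimately have "coord_frame n ?P ?Q"
    using transvection_elem_mat[OF abc(1,2,4) one] transvection_elem_mat[OF abc(2,3,5) one] mats(3)[OF one]
    unfolding coord_frame_def by blast
  then show ?thesis using mats one by blast
qed

section \<open>Counting the positions\<close>

text \<open>Classes of transvections under \<open>same_root\<close> correspond to ordered pairs of
  distinct indices, so \<open>k\<close> inequivalent ones exist iff \<open>k\<close> is at most the
  number of such pairs.\<close>

lemma root_count:
  "(\<exists>f :: nat \<Rightarrow> 'a mat. (\<forall>i<k. f i \<in> nonneg_mats n \<and> transvection n (f i)) \<and>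
      (\<forall>i<k. \<forall>j<i. \<not> same_root n (f i) (f j))) \<longleftrightarrow> k \<le> n * (n - 1)" (is "?L \<longleftrightarrow> _")
proof -
  define R where "R = (SIGMA a:{..<n}. {..<n} - {a})"
  have fin: "finite R" by (simp add: R_def)
  have cR: "card R = n * (n - 1)" by (simp add: R_def card_SigmaI card_Diff_singleton)
  have R: "(a, b) \<in> R \<longleftrightarrow> a < n \<and> b < n \<and> a \<noteq> b" for a b by (auto simp: R_def)
  show ?thesis
  proof
    assume ?L
    then obtain f :: "nat \<Rightarrow> 'a mat" where f: "\<And>i. i < k \<Longrightarrow> f i \<in> nonneg_mats n" "\<And>i. i < k \<Longrightarrow> transvection n (f i)"
      and ns: "\<And>i j. i < k \<Longrightarrow> j < i \<Longrightarrow> \<not> same_root n (f i) (f j)" by blast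
    have "\<exists>r x. r \<in> R \<and> 0 < x \<and> f i = elem_mat (fst r) (snd r) x" if "i < k" for i
      using transvectionE[OF f[OF that]] R by (metis fst_conv snd_conv)
    then obtain r x where r: "\<And>i. i < k \<Longrightarrow> r i \<in> R" "\<And>i. i < k \<Longrightarrow> 0 < x i"
      "\<And>i. i < k \<Longrightarrow> f i = elem_mat (fst (r i)) (snd (r i)) (x i)" by metis
    have "inj_on r {..<k}"
    proof (rule linorder_inj_onI')
      fix i j assume "i \<in> {..<k}" "j \<in> {..<k}" "i < j"
      then have ij: "i < k" "j < k" "i < j" by auto
      have "fst (r l) < n" "snd (r l) < n" "fst (r l) \<noteq> snd (r l)" if "l < k" for l
        using r(1)[OF that] R[of "fst (r l)" "snd (r l)"] by auto
      then have "r i \<noteq> r j"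
        using ns[OF ij(2,3)] same_root_elem_mat_iff r ij by metis
      then show "r i \<noteq> r j" .
    qed
    moreover have "r ` {..<k} \<subseteq> R" using r by auto
    ultimately show "k \<le> n * (n - 1)" using card_inj_on_le[OF _ _ fin] cR by fastforce
  next
    assume "k \<le> n * (n - 1)"
    then obtain r where r: "inj_on r {..<k}" "r ` {..<k} \<subseteq> R"
      using card_le_inj[OF _ fin, of "{..<k}"] cR by auto
    define f :: "nat \<Rightarrow> 'a mat" where "f i = elem_mat (fst (r i)) (snd (r i)) 1" for i
    have rn: "fst (r i) < n" "snd (r i) < n" "fst (r i) \<noteq> snd (r i)" if "i < k" for i
      using r(2) R[of "fst (r i)" "snd (r i)"] that by auto
    have "f i \<in> nonneg_mats n" "transvection n (f i)" if "i < k" for i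
      using rn[OF that] one_pos[where 'a='a] unfolding f_def
      by (auto intro!: elem_mat_nonneg_mats transvection_elem_mat simp: less_imp_le)
    moreover have "\<not> same_root n (f i) (f j)" if "i < k" "j < i" for i j
    proof -
      have "j < k" using that by simp
      then have "r i \<noteq> r j" using inj_onD[OF r(1), of i j] that by auto
      then show ?thesis
        unfolding f_def same_root_elem_mat_iff[OF rn[OF that(1)] one_pos rn[OF \<open>j < k\<close>] one_pos]
        by (auto simp: prod_eq_iff)
    qed
    ultimately show ?L by blast
  qed
qed

end

section \<open>First-order formulas\<close>

definition Ex_fml :: "nat \<Rightarrow> 'f fml \<Rightarrow> 'f fml" where
  "Ex_fml x p = Neg (All x (Neg p))"

definition Imp_fml :: "'f fml \<Rightarrow> 'f fml \<Rightarrow> 'f fml" where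
  "Imp_fml p q = Neg (Conj p (Neg q))"

definition Iff_fml :: "'f fml \<Rightarrow> 'f fml \<Rightarrow> 'f fml" where
  "Iff_fml p q = Conj (Imp_fml p q) (Imp_fml q p)"

definition Conjs :: "'f fml list \<Rightarrow> 'f fml" where
  "Conjs ps = foldr Conj ps (Eq (Var 0) (Var 0))"

lemma sat_Ex_fml [simp]: "sat M e (Ex_fml x p) \<longleftrightarrow> (\<exists>a\<in>universe M. sat M (e(x := a)) p)"
  by (simp add: Ex_fml_def)

lemma sat_Imp_fml [simp]: "sat M e (Imp_fml p q) \<longleftrightarrow> (sat M e p \<longrightarrow> sat M e q)"
  by (simp add: Imp_fml_def)

lemma sat_Iff_fml [simp]: "sat M e (Iff_fml p q) \<longleftrightarrow> (sat M e p \<longleftrightarrow> sat M e q)"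
  by (auto simp: Iff_fml_def)

lemma sat_Conjs [simp]: "sat M e (Conjs ps) \<longleftrightarrow> (\<forall>p\<in>set ps. sat M e p)"
  by (induction ps) (auto simp: Conjs_def)

lemma finite_fv_trm: "finite (fv_trm t)"
  by (induction t) auto

lemma finite_fv: "finite (fv p)"
  by (induction p) (auto simp: finite_fv_trm)

lemma eval_trm_cong: "(\<And>x. x \<in> fv_trm t \<Longrightarrow> e x = e' x) \<Longrightarrow> eval_trm M e t = eval_trm M e' t"
  by (induction t) auto

lemma sat_cong: "(\<And>x. x \<in> fv p \<Longrightarrow> e x = e' x) \<Longrightarrow> sat M e p \<longleftrightarrow> sat M e' p"
proof (induction p arbitrary: e e')
  case (Eq s t)
  then have "eval_trm M e s = eval_trm M e' s" "eval_trm M e t = eval_trm M e' t"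
    by (auto intro: eval_trm_cong)
  then show ?case by simp
next
  case (Neg p)
  have "sat M e p \<longleftrightarrow> sat M e' p" using Neg.prems by (intro Neg.IH) auto
  then show ?case by simp
next
  case (Conj p q)
  have "sat M e p \<longleftrightarrow> sat M e' p" "sat M e q \<longleftrightarrow> sat M e' q"
    using Conj.prems by (auto intro!: Conj.IH)
  then show ?case by simp
next
  case (All x p)
  have "sat M (e(x := a)) p \<longleftrightarrow> sat M (e'(x := a)) p" for a
    using All.prems by (intro All.IH) auto
  then show ?case by simp
qed

text \<open>A sentence may be tested at any assignment \<open>e\<close>, even one with values
  outside the universe. The element \<open>a\<close> ensures that \<open>true_in\<close> does not
  hold vacuously.\<close>

lemma sentence_true_in_iff:
  assumes "sentence p" "a \<in> universe M"
  shows "true_in M p \<longleftrightarrow> sat M e p"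
proof
  assume "true_in M p"
  then have "sat M (\<lambda>_. a) p" using assms by (auto simp: true_in_def)
  then show "sat M e p" using sat_cong[of p e "\<lambda>_. a" M] assms by (simp add: sentence_def)
next
  assume "sat M e p"
  then have "sat M e' p" for e' using sat_cong[of p e e' M] assms by (simp add: sentence_def)
  then show "true_in M p" by (simp add: true_in_def)
qed

lemma true_in_All: "true_in M (All x p) \<longleftrightarrow> true_in M p"
proof
  assume L: "true_in M (All x p)"
  show "true_in M p"
    unfolding true_in_def
  proof (intro allI impI)
    fix e :: "nat \<Rightarrow> 'b" assume e: "range e \<subseteq> universe M"
    then have "sat M (e(x := e x)) p" using L by (auto simp: true_in_def simp del: fun_upd_triv)
    then show "sat M e p" by simp
  qed
next
  assume R: "true_in M p"
  have "sat M (e(x := a)) p" if "range e \<subseteq> universe M" "a \<in> universe M" for e a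
  proof -
    have "range (e(x := a)) \<subseteq> universe M" using that by auto
    then show ?thesis using R by (simp add: true_in_def)
  qed
  then show "true_in M (All x p)" by (simp add: true_in_def)
qed

lemma true_in_foldr_All: "true_in M (foldr All xs p) \<longleftrightarrow> true_in M p"
  by (induction xs) (auto simp: true_in_All)

text \<open>\<open>true_in\<close> reads free variables universally, so a formula and its universal
  closure are true in the same models. Translated formulas may therefore keep free
  variables.\<close>

lemma elementarily_equivalent_iff:
  "elementarily_equivalent M N \<longleftrightarrow> (\<forall>p. true_in M p \<longleftrightarrow> true_in N p)"
proof
  assume E: "elementarily_equivalent M N"
  show "\<forall>p. true_in M p \<longleftrightarrow> true_in N p"
  proof
    fix p :: "'a fml"
    have "fv (foldr All xs p) = fv p - set xs" for xs
      by (induction xs) auto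
    then have "sentence (foldr All (sorted_list_of_set (fv p)) p)"
      by (simp add: sentence_def finite_fv)
    then show "true_in M p \<longleftrightarrow> true_in N p"
      using E unfolding elementarily_equivalent_def by (metis true_in_foldr_All)
  qed
qed (simp add: elementarily_equivalent_def)

section \<open>The defining formulas\<close>

abbreviation sg_mult :: "semigroup_sym trm \<Rightarrow> semigroup_sym trm \<Rightarrow> semigroup_sym trm" where
  "sg_mult \<equiv> App SgMult"

definition inv_pair_fml :: "nat \<Rightarrow> nat \<Rightarrow> semigroup_sym fml" where
  "inv_pair_fml x y =
     Eq (sg_mult (sg_mult (Var x) (Var y)) (sg_mult (Var x) (Var y))) (sg_mult (Var x) (Var y))"

definition conj_commutes_fml :: "nat \<Rightarrow> nat \<Rightarrow> nat \<Rightarrow> semigroup_sym fml" where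
  "conj_commutes_fml x d d' =
     Eq (sg_mult (sg_mult (Var x) (Var d)) (sg_mult (Var x) (Var d')))
        (sg_mult (sg_mult (Var d) (Var x)) (sg_mult (Var d') (Var x)))"

definition commute_fml :: "nat \<Rightarrow> nat \<Rightarrow> semigroup_sym fml" where
  "commute_fml x y = Eq (sg_mult (Var x) (Var y)) (sg_mult (Var y) (Var x))"

definition idem_fml :: "nat \<Rightarrow> semigroup_sym fml" where
  "idem_fml x = Eq (sg_mult (Var x) (Var x)) (Var x)"

text \<open>Here and below, bound variables get numbers above those of the parameters. A subformula
  may rebind a number in use around it, since it refers only to its own parameters.\<close>

definition torus_fml :: "nat \<Rightarrow> semigroup_sym fml" where
  "torus_fml x = Conj (Ex_fml (x + 1) (inv_pair_fml x (x + 1)))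
     (All (x + 1) (All (x + 2)
       (Imp_fml (inv_pair_fml (x + 1) (x + 2)) (conj_commutes_fml x (x + 1) (x + 2)))))"

definition quasi_root_fml :: "nat \<Rightarrow> semigroup_sym fml" where
  "quasi_root_fml x = Conj
     (All (x + 1) (All (x + 2) (Imp_fml
        (Conj (torus_fml (x + 1)) (inv_pair_fml (x + 1) (x + 2)))
        (conj_commutes_fml x (x + 1) (x + 2)))))
     (Ex_fml (x + 1) (Conj (torus_fml (x + 1))
        (Eq (sg_mult (Var (x + 1)) (Var x)) (sg_mult (sg_mult (Var x) (Var x)) (Var (x + 1))))))"

definition transvection_fml :: "nat \<Rightarrow> semigroup_sym fml" where
  "transvection_fml x = Conj (quasi_root_fml x) (Conj (Neg (idem_fml x))
     (All (x + 1) (All (x + 2) (Imp_fml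
        (Conjs [quasi_root_fml (x + 1), quasi_root_fml (x + 2), Neg (idem_fml (x + 1)),
           Neg (idem_fml (x + 2)), Eq (Var x) (sg_mult (Var (x + 1)) (Var (x + 2)))])
        (All (x + 3) (Imp_fml (quasi_root_fml (x + 3))
           (Iff_fml (commute_fml (x + 3) (x + 1)) (commute_fml (x + 3) (x + 2)))))))))"

definition same_root_fml :: "nat \<Rightarrow> nat \<Rightarrow> semigroup_sym fml" where
  "same_root_fml x y = All (x + y + 1) (Imp_fml (transvection_fml (x + y + 1))
     (Iff_fml (commute_fml (x + y + 1) x) (commute_fml (x + y + 1) y)))"

definition product_root_fml :: "nat \<Rightarrow> nat \<Rightarrow> nat \<Rightarrow> semigroup_sym fml" where
  "product_root_fml x y z = Conj (transvection_fml z)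
     (Eq (sg_mult (Var x) (Var y)) (sg_mult (sg_mult (Var y) (Var x)) (Var z)))"

definition coord_dom_fml :: "nat \<Rightarrow> nat \<Rightarrow> nat \<Rightarrow> semigroup_sym fml" where
  "coord_dom_fml p q c = Conj (transvection_fml c) (Ex_fml (p + q + c + 1)
     (Conj (product_root_fml p q (p + q + c + 1)) (same_root_fml c (p + q + c + 1))))"

definition coord_left_fml :: "nat \<Rightarrow> nat \<Rightarrow> nat \<Rightarrow> nat \<Rightarrow> semigroup_sym fml" where
  "coord_left_fml p q c x = Conjs [transvection_fml x, same_root_fml x p, product_root_fml x q c]"

definition coord_right_fml :: "nat \<Rightarrow> nat \<Rightarrow> nat \<Rightarrow> nat \<Rightarrow> semigroup_sym fml" where
  "coord_right_fml p q c y = Conjs [transvection_fml y, same_root_fml y q, product_root_fml p y c]"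

definition coord_frame_fml :: "nat \<Rightarrow> nat \<Rightarrow> semigroup_sym fml" where
  "coord_frame_fml p q = Conjs [transvection_fml p, transvection_fml q,
     Ex_fml (p + q + 1) (product_root_fml p q (p + q + 1)),
     All (p + q + 1) (Imp_fml (coord_dom_fml p q (p + q + 1))
       (Conj (Ex_fml (p + q + 2) (coord_left_fml p q (p + q + 1) (p + q + 2)))
         (Ex_fml (p + q + 2) (coord_right_fml p q (p + q + 1) (p + q + 2)))))]"

definition coord_mult_fml :: "nat \<Rightarrow> nat \<Rightarrow> nat \<Rightarrow> nat \<Rightarrow> nat \<Rightarrow> semigroup_sym fml" where
  "coord_mult_fml p q a b c =
     Ex_fml (p + q + a + b + c + 1) (Ex_fml (p + q + a + b + c + 2)
       (Conjs [coord_left_fml p q a (p + q + a + b + c + 1),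
          coord_right_fml p q b (p + q + a + b + c + 2),
          product_root_fml (p + q + a + b + c + 1) (p + q + a + b + c + 2) c]))"

context
  fixes n :: nat and M :: "(semigroup_sym, 'a::{ring_1, linordered_ring_strict} mat) op_model"
  defines "M \<equiv> nonneg_semigroup TYPE('a) n"
begin

lemma universe_M: "universe M = nonneg_mats n" and oper_M: "oper M f = (*)"
  by (simp_all add: M_def nonneg_semigroup_def nonneg_mats_def)

lemma sat_inv_pair_fml: "sat M e (inv_pair_fml x y) \<longleftrightarrow> inv_pair (e x) (e y)"
  by (simp add: inv_pair_fml_def inv_pair_def oper_M)

lemma sat_conj_commutes_fml: "sat M e (conj_commutes_fml x y z) \<longleftrightarrow> conj_commutes (e x) (e y) (e z)"
  by (simp add: conj_commutes_fml_def conj_commutes_def oper_M)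

lemma sat_commute_fml: "sat M e (commute_fml x y) \<longleftrightarrow> e x * e y = e y * e x"
  by (simp add: commute_fml_def oper_M)

lemma sat_idem_fml: "sat M e (idem_fml x) \<longleftrightarrow> e x * e x = e x"
  by (simp add: idem_fml_def oper_M)

lemma sat_torus_fml: "sat M e (torus_fml x) \<longleftrightarrow> torus n (e x)"
  by (simp add: torus_fml_def torus_def universe_M sat_inv_pair_fml sat_conj_commutes_fml)

lemma sat_quasi_root_fml: "sat M e (quasi_root_fml x) \<longleftrightarrow> quasi_root n (e x)"
  by (simp add: quasi_root_fml_def quasi_root_def universe_M oper_M sat_inv_pair_fml
      sat_conj_commutes_fml sat_torus_fml)

lemma sat_transvection_fml: "sat M e (transvection_fml x) \<longleftrightarrow> transvection n (e x)"
  by (simp add: transvection_fml_def transvection_def universe_M oper_M sat_quasi_root_fml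
      sat_idem_fml sat_commute_fml)

lemma sat_same_root_fml: "sat M e (same_root_fml x y) \<longleftrightarrow> same_root n (e x) (e y)"
  by (simp add: same_root_fml_def same_root_def universe_M sat_transvection_fml sat_commute_fml)

lemma sat_product_root_fml: "sat M e (product_root_fml x y z) \<longleftrightarrow> product_root n (e x) (e y) (e z)"
  by (simp add: product_root_fml_def product_root_def oper_M sat_transvection_fml)

lemma sat_coord_dom_fml: "sat M e (coord_dom_fml p q c) \<longleftrightarrow> coord_dom n (e p) (e q) (e c)"
  by (simp add: coord_dom_fml_def coord_dom_def universe_M sat_transvection_fml
      sat_product_root_fml sat_same_root_fml)

lemma sat_coord_left_fml:
  "sat M e (coord_left_fml p q c x) \<longleftrightarrow> coord_left n (e p) (e q) (e c) (e x)"
  by (simp add: coord_left_fml_def coord_left_def sat_transvection_fml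
      sat_product_root_fml sat_same_root_fml)

lemma sat_coord_right_fml:
  "sat M e (coord_right_fml p q c x) \<longleftrightarrow> coord_right n (e p) (e q) (e c) (e x)"
  by (simp add: coord_right_fml_def coord_right_def sat_transvection_fml
      sat_product_root_fml sat_same_root_fml)

lemma sat_coord_frame_fml: "sat M e (coord_frame_fml p q) \<longleftrightarrow> coord_frame n (e p) (e q)"
  by (simp add: coord_frame_fml_def coord_frame_def universe_M sat_transvection_fml
      sat_product_root_fml sat_coord_dom_fml sat_coord_left_fml sat_coord_right_fml)

lemma sat_coord_mult_fml:
  "sat M e (coord_mult_fml p q a b c) \<longleftrightarrow> coord_mult n (e p) (e q) (e a) (e b) (e c)"
  by (simp add: coord_mult_fml_def coord_mult_def universe_M sat_product_root_fml
      sat_coord_left_fml sat_coord_right_fml)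

end

section \<open>Interpreting the positive semiring in the matrix semigroup\<close>

text \<open>Variables 0 and 2 hold the frame, the semiring variable \<open>k\<close> becomes \<open>2 * k + 4\<close>, and odd
  variables are auxiliary.\<close>

primrec coord_graph :: "semiring_sym trm \<Rightarrow> nat \<Rightarrow> semigroup_sym fml" where
  "coord_graph (Var k) z = Eq (Var z) (Var (2 * k + 4))"
| "coord_graph (App f s t) z = Ex_fml (z + 2) (Ex_fml (z + 4)
     (Conjs [coord_graph s (z + 2), coord_graph t (z + 4),
        case f of SrAdd \<Rightarrow> Eq (Var z) (sg_mult (Var (z + 2)) (Var (z + 4)))
        | SrMult \<Rightarrow> coord_mult_fml 0 2 (z + 2) (z + 4) z]))"

primrec coord_fml :: "semiring_sym fml \<Rightarrow> semigroup_sym fml" where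
  "coord_fml (Eq s t) = Ex_fml 1 (Conj (coord_graph s 1) (coord_graph t 1))"
| "coord_fml (Neg p) = Neg (coord_fml p)"
| "coord_fml (Conj p q) = Conj (coord_fml p) (coord_fml q)"
| "coord_fml (All k p) = All (2 * k + 4) (Imp_fml (coord_dom_fml 0 2 (2 * k + 4)) (coord_fml p))"

text \<open>Variables 0 and 2 stay free, so truth of this formula speaks of all frames at
  once.\<close>

definition interp_fml :: "semiring_sym fml \<Rightarrow> semigroup_sym fml" where
  "interp_fml p = Imp_fml (coord_frame_fml 0 2) (coord_fml p)"

lemma universe_pos_semiring [simp]: "universe (pos_semiring TYPE('a)) = {r::'a::{ring_1, linordered_ring_strict}. 0 < r}"
  by (simp add: pos_semiring_def)

lemma oper_pos_semiring [simp]: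
  "oper (pos_semiring TYPE('a)) SrAdd = ((+) :: 'a \<Rightarrow> 'a \<Rightarrow> 'a::{ring_1, linordered_ring_strict})"
  "oper (pos_semiring TYPE('a)) SrMult = ((*) :: 'a \<Rightarrow> 'a \<Rightarrow> 'a)"
  by (simp_all add: pos_semiring_def)

lemma eval_trm_pos:
  fixes r :: "nat \<Rightarrow> 'a::{ring_1, linordered_ring_strict}"
  assumes "\<And>k. k \<in> fv_trm t \<Longrightarrow> 0 < r k"
  shows "0 < eval_trm (pos_semiring TYPE('a)) r t"
  using assms
proof (induction t)
  case (App f s t)
  then have "0 < eval_trm (pos_semiring TYPE('a)) r s" "0 < eval_trm (pos_semiring TYPE('a)) r t"
    by simp_all
  then show ?case by (cases f) (auto intro: add_pos_pos)
qed simp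

context half_mats
begin

abbreviation "GM \<equiv> nonneg_semigroup TYPE('a) n"
abbreviation "PM \<equiv> pos_semiring TYPE('a)"

context
  fixes P Q :: "'a mat" and \<iota> :: "'a \<Rightarrow> 'a mat"
  assumes \<iota>_mem: "\<And>r. 0 < r \<Longrightarrow> \<iota> r \<in> nonneg_mats n"
    and \<iota>_inj: "\<And>r s. 0 < r \<Longrightarrow> 0 < s \<Longrightarrow> \<iota> r = \<iota> s \<Longrightarrow> r = s"
    and \<iota>_dom: "\<And>C. C \<in> nonneg_mats n \<Longrightarrow> coord_dom n P Q C \<longleftrightarrow> (\<exists>r>0. C = \<iota> r)"
    and \<iota>_add: "\<And>r s. 0 < r \<Longrightarrow> 0 < s \<Longrightarrow> \<iota> r * \<iota> s = \<iota> (r + s)"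
    and \<iota>_mult: "\<And>r s C. 0 < r \<Longrightarrow> 0 < s \<Longrightarrow> C \<in> nonneg_mats n \<Longrightarrow>
      coord_mult n P Q (\<iota> r) (\<iota> s) C \<longleftrightarrow> C = \<iota> (r * s)"
begin

lemma sat_coord_graph:
  assumes "odd z" "e 0 = P" "e 2 = Q" "e z \<in> nonneg_mats n"
    and "\<And>k. k \<in> fv_trm t \<Longrightarrow> 0 < r k \<and> e (2 * k + 4) = \<iota> (r k)"
  shows "sat GM e (coord_graph t z) \<longleftrightarrow> e z = \<iota> (eval_trm PM r t)"
  using assms
proof (induction t arbitrary: z e)
  case (Var k)
  then show ?case by simp
next
  case (App f s t)
  define x y where "x = eval_trm PM r s" and "y = eval_trm PM r t"
  have pos: "0 < x" "0 < y" unfolding x_def y_def using App.prems(5) by (auto intro!: eval_trm_pos)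
  \<comment> \<open>Oddness of \<open>z\<close> keeps the auxiliary variables apart from the frame
    and from the coordinate variables.\<close>
  have ne: "2 * k + 4 \<noteq> z + 2" "2 * k + 4 \<noteq> z + 4" "0 \<noteq> z + 2" "0 \<noteq> z + 4" "2 \<noteq> z + 2" "2 \<noteq> z + 4" for k :: nat
    using App.prems(1) by presburger+
  let ?e = "\<lambda>A B. e(z + 2 := A, z + 4 := B)"
  have s: "sat GM (?e A B) (coord_graph s (z + 2)) \<longleftrightarrow> A = \<iota> x"
    and t: "sat GM (?e A B) (coord_graph t (z + 4)) \<longleftrightarrow> B = \<iota> y"
    if "A \<in> nonneg_mats n" "B \<in> nonneg_mats n" for A B
  proof -
    define e' where "e' = ?e A B"
    have e': "odd (z + 2)" "odd (z + 4)" "e' 0 = P" "e' 2 = Q" "e' (z + 2) = A" "e' (z + 4) = B"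
      "e' (2 * k + 4) = e (2 * k + 4)" for k
      using App.prems(1-3) ne by (simp_all add: e'_def)
    show "sat GM (?e A B) (coord_graph s (z + 2)) \<longleftrightarrow> A = \<iota> x"
      using App.IH(1)[of "z + 2" e'] App.prems(5) that(1) e' unfolding e'_def[symmetric] x_def by simp
    show "sat GM (?e A B) (coord_graph t (z + 4)) \<longleftrightarrow> B = \<iota> y"
      using App.IH(2)[of "z + 4" e'] App.prems(5) that(2) e' unfolding e'_def[symmetric] y_def by simp
  qed
  have f: "sat GM (?e (\<iota> x) (\<iota> y)) (case f of SrAdd \<Rightarrow> Eq (Var z) (sg_mult (Var (z + 2)) (Var (z + 4)))
        | SrMult \<Rightarrow> coord_mult_fml 0 2 (z + 2) (z + 4) z) \<longleftrightarrow> e z = \<iota> (oper PM f x y)"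
    using App.prems(2-4) ne pos \<iota>_add \<iota>_mult[OF pos App.prems(4)]
    by (cases f) (simp_all add: sat_coord_mult_fml oper_M)
  have "sat GM e (coord_graph (App f s t) z) \<longleftrightarrow> e z = \<iota> (oper PM f x y)"
    using s t f \<iota>_mem[OF pos(1)] \<iota>_mem[OF pos(2)]
    by (auto simp: universe_M simp del: fun_upd_apply)
  then show ?case by (simp add: x_def y_def)
qed

text \<open>Injectivity of \<open>\<iota>\<close> settles equations; quantifiers are settled because
  \<open>coord_dom\<close> describes the image of the positive elements under
  \<open>\<iota>\<close>.\<close>

lemma sat_coord_fml:
  assumes "e 0 = P" "e 2 = Q" and "\<And>k. k \<in> fv p \<Longrightarrow> 0 < r k \<and> e (2 * k + 4) = \<iota> (r k)"
  shows "sat GM e (coord_fml p) \<longleftrightarrow> sat PM r p"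
  using assms
proof (induction p arbitrary: e r)
  case (Eq s t)
  have "sat GM (e(1 := C)) (coord_graph u 1) \<longleftrightarrow> C = \<iota> (eval_trm PM r u)"
    if "C \<in> nonneg_mats n" "u = s \<or> u = t" for C u
  proof -
    have "(2::nat) * k + 4 \<noteq> 1" for k by presburger
    then show ?thesis
      using sat_coord_graph[of 1 "e(1 := C)" u r] Eq.prems that by auto
  qed
  moreover have "0 < eval_trm PM r s" "0 < eval_trm PM r t"
    using Eq.prems(3) by (auto intro!: eval_trm_pos)
  ultimately show ?case
    using \<iota>_mem \<iota>_inj by (auto simp: universe_M simp del: fun_upd_apply One_nat_def)
next
  case (Neg p)
  then show ?case by simp
next
  case (Conj p q)
  have "sat GM e (coord_fml p) \<longleftrightarrow> sat PM r p" "sat GM e (coord_fml q) \<longleftrightarrow> sat PM r q"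
    using Conj.IH(1)[of e r] Conj.IH(2)[of e r] Conj.prems by simp_all
  then show ?case by simp
next
  case (All x p)
  have "sat GM (e(2 * x + 4 := \<iota> a)) (coord_fml p) \<longleftrightarrow> sat PM (r(x := a)) p" if "0 < a" for a
    using All.prems that by (intro All.IH) auto
  moreover have "coord_dom n ((e(2 * x + 4 := C)) 0) ((e(2 * x + 4 := C)) 2) ((e(2 * x + 4 := C)) (2 * x + 4))
      \<longleftrightarrow> (\<exists>r>0. C = \<iota> r)" if "C \<in> nonneg_mats n" for C
    using \<iota>_dom[OF that] All.prems by simp
  ultimately show ?case
    using \<iota>_mem by (auto simp: universe_M sat_coord_dom_fml simp del: fun_upd_apply)
qed

end

text \<open>Every frame yields a copy of the positive semiring, so all frames give the same verdict
  on a sentence, and at least one frame exists.\<close>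

lemma true_in_interp_fml:
  assumes "sentence p"
  shows "true_in GM (interp_fml p) \<longleftrightarrow> true_in PM p"
proof -
  have coord: "sat GM e (coord_fml p) \<longleftrightarrow> true_in PM p"
    if e: "e 0 \<in> nonneg_mats n" "e 2 \<in> nonneg_mats n" and fr: "coord_frame n (e 0) (e 2)" for e
  proof -
    obtain \<iota> :: "'a \<Rightarrow> 'a mat" where *: 
      "\<And>r. 0 < r \<Longrightarrow> \<iota> r \<in> nonneg_mats n"
      "\<And>r s. 0 < r \<Longrightarrow> 0 < s \<Longrightarrow> \<iota> r = \<iota> s \<Longrightarrow> r = s"
      "\<And>C. C \<in> nonneg_mats n \<Longrightarrow> coord_dom n (e 0) (e 2) C \<longleftrightarrow> (\<exists>r>0. C = \<iota> r)"
      "\<And>r s. 0 < r \<Longrightarrow> 0 < s \<Longrightarrow> \<iota> r * \<iota> s = \<iota> (r + s)"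
      "\<And>r s C. 0 < r \<Longrightarrow> 0 < s \<Longrightarrow> C \<in> nonneg_mats n \<Longrightarrow>
        coord_mult n (e 0) (e 2) (\<iota> r) (\<iota> s) C \<longleftrightarrow> C = \<iota> (r * s)"
      using coord_frameE[OF e fr] by blast
    have "sat GM e (coord_fml p) \<longleftrightarrow> sat PM (\<lambda>_. 1) p"
      by (rule sat_coord_fml[OF *]) (use assms in \<open>auto simp: sentence_def\<close>)
    also have "\<dots> \<longleftrightarrow> true_in PM p"
      using sentence_true_in_iff[OF assms, of 1 PM] one_pos by auto
    finally show ?thesis .
  qed
  obtain P Q :: "'a mat" where PQ: "P \<in> nonneg_mats n" "Q \<in> nonneg_mats n" "coord_frame n P Q"
    using ex_coord_frame by blast
  show ?thesis
  proof
    assume L: "true_in GM (interp_fml p)"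
    define e where "e = (\<lambda>k::nat. if k = 2 then Q else P)"
    have "range e \<subseteq> nonneg_mats n" using PQ by (auto simp: e_def)
    then have "sat GM e (interp_fml p)"
      using L by (simp add: true_in_def universe_M)
    then show "true_in PM p"
      using coord[of e] PQ by (simp add: interp_fml_def sat_coord_frame_fml e_def)
  next
    assume "true_in PM p"
    then have "sat GM e (interp_fml p)" if "range e \<subseteq> nonneg_mats n" for e
      using coord[of e] that by (simp add: range_subsetD interp_fml_def sat_coord_frame_fml)
    then show "true_in GM (interp_fml p)" by (simp add: true_in_def universe_M)
  qed
qed

end

section \<open>Expressing the number of positions\<close>

definition roots_fml :: "nat \<Rightarrow> semigroup_sym fml" where
  "roots_fml k = Conjs (map transvection_fml [0..<k] @
     concat (map (\<lambda>i. map (\<lambda>j. Neg (same_root_fml i j)) [0..<i]) [0..<k]))"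

text \<open>Since \<open>true_in\<close> quantifies universally over assignments, it is the negated
  formula whose truth says that no \<open>k\<close> inequivalent transvections exist.\<close>

lemma (in half_mats) true_in_roots_fml:
  "true_in GM (Neg (roots_fml k)) \<longleftrightarrow> \<not> k \<le> n * (n - 1)"
proof -
  have sat: "sat GM e (roots_fml k) \<longleftrightarrow>
      (\<forall>i<k. transvection n (e i)) \<and> (\<forall>i<k. \<forall>j<i. \<not> same_root n (e i) (e j))" for e
    by (simp add: roots_fml_def ball_Un sat_transvection_fml sat_same_root_fml) auto
  obtain P :: "'a mat" where P: "P \<in> nonneg_mats n" using ex_coord_frame by blast
  have "(\<exists>e. range e \<subseteq> nonneg_mats n \<and> sat GM e (roots_fml k)) \<longleftrightarrow> k \<le> n * (n - 1)"
    unfolding root_count[symmetric]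
  proof
    assume "\<exists>e. range e \<subseteq> nonneg_mats n \<and> sat GM e (roots_fml k)"
    then obtain e where "range e \<subseteq> nonneg_mats n" "sat GM e (roots_fml k)" by blast
    then show "\<exists>f :: nat \<Rightarrow> 'a mat. (\<forall>i<k. f i \<in> nonneg_mats n \<and> transvection n (f i)) \<and>
        (\<forall>i<k. \<forall>j<i. \<not> same_root n (f i) (f j))"
      unfolding sat by (intro exI[of _ e]) auto
  next
    assume "\<exists>f :: nat \<Rightarrow> 'a mat. (\<forall>i<k. f i \<in> nonneg_mats n \<and> transvection n (f i)) \<and>
        (\<forall>i<k. \<forall>j<i. \<not> same_root n (f i) (f j))"
    then obtain f :: "nat \<Rightarrow> 'a mat" where "\<forall>i<k. f i \<in> nonneg_mats n \<and> transvection n (f i)"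
      "\<forall>i<k. \<forall>j<i. \<not> same_root n (f i) (f j)" by blast
    then show "\<exists>e. range e \<subseteq> nonneg_mats n \<and> sat GM e (roots_fml k)"
      \<comment> \<open>Variables from \<open>k\<close> on receive the value \<open>P\<close>, to
        keep the assignment inside the universe.\<close>
      unfolding sat using P by (intro exI[of _ "\<lambda>i. if i < k then f i else P"]) auto
  qed
  then show ?thesis by (auto simp: true_in_def universe_M)
qed

section \<open>Interpreting the matrix semigroup in the positive semiring\<close>

text \<open>An entry is represented as a difference of two positive elements, those with last index 0 and 1.\<close>

definition mvar :: "nat \<Rightarrow> nat \<Rightarrow> nat \<Rightarrow> nat \<Rightarrow> nat" where
  "mvar k i j s = prod_encode (k, prod_encode (i, prod_encode (j, s)))"

lemma mvar_eq_iff [simp]: "mvar k i j s = mvar k' i' j' s' \<longleftrightarrow> k = k' \<and> i = i' \<and> j = j' \<and> s = s'"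
  by (simp add: mvar_def)

text \<open>The positive semiring has no zero to serve as an empty sum, so the last index is
  included and a sum over \<open>n\<close> indices is called with \<open>n - 1\<close>.\<close>

primrec sum_trm :: "(nat \<Rightarrow> semiring_sym trm) \<Rightarrow> nat \<Rightarrow> semiring_sym trm" where
  "sum_trm f 0 = f 0"
| "sum_trm f (Suc l) = App SrAdd (sum_trm f l) (f (Suc l))"

text \<open>Products of differences follow
  \<open>(a - b) (c - d) = (a c + b d) - (a d + b c)\<close>; the first component is the positive
  part and the second is subtracted.\<close>

primrec entry_trm :: "nat \<Rightarrow> semigroup_sym trm \<Rightarrow> nat \<Rightarrow> nat \<Rightarrow> semiring_sym trm \<times> semiring_sym trm" where
  "entry_trm n (Var k) = (\<lambda>i j. (Var (mvar k i j 0), Var (mvar k i j 1)))"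
| "entry_trm n (App f s t) = (\<lambda>i j.
     (sum_trm (\<lambda>l. App SrAdd
          (App SrMult (fst (entry_trm n s i l)) (fst (entry_trm n t l j)))
          (App SrMult (snd (entry_trm n s i l)) (snd (entry_trm n t l j)))) (n - 1),
      sum_trm (\<lambda>l. App SrAdd
          (App SrMult (fst (entry_trm n s i l)) (snd (entry_trm n t l j)))
          (App SrMult (snd (entry_trm n s i l)) (fst (entry_trm n t l j)))) (n - 1)))"

text \<open>\<open>a - b = c - d\<close> is expressed without subtraction as
  \<open>a + d = c + b\<close>.\<close>

definition mat_eq_fml :: "nat \<Rightarrow> semigroup_sym trm \<Rightarrow> semigroup_sym trm \<Rightarrow> semiring_sym fml" where
  "mat_eq_fml n s t = Conjs (concat (map (\<lambda>i. map (\<lambda>j.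
     Eq (App SrAdd (fst (entry_trm n s i j)) (snd (entry_trm n t i j)))
        (App SrAdd (fst (entry_trm n t i j)) (snd (entry_trm n s i j)))) [0..<n]) [0..<n]))"

definition mvars :: "nat \<Rightarrow> nat \<Rightarrow> nat list" where
  "mvars n k = concat (map (\<lambda>i. concat (map (\<lambda>j. [mvar k i j 0, mvar k i j 1]) [0..<n])) [0..<n])"

definition All_mat :: "nat \<Rightarrow> nat \<Rightarrow> semiring_sym fml \<Rightarrow> semiring_sym fml" where
  "All_mat n k p = foldr All (mvars n k) p"

text \<open>A difference \<open>a - b\<close> is nonnegative iff no positive \<open>c\<close>
  satisfies \<open>b = a + c\<close>; a variable of the block \<open>k + 1\<close> serves as
  \<open>c\<close>.\<close>

definition nonneg_fml :: "nat \<Rightarrow> nat \<Rightarrow> semiring_sym fml" where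
  "nonneg_fml n k = Conjs (concat (map (\<lambda>i. map (\<lambda>j.
     All (mvar (k + 1) 0 0 0) (Neg (Eq (Var (mvar k i j 1))
       (App SrAdd (Var (mvar k i j 0)) (Var (mvar (k + 1) 0 0 0)))))) [0..<n]) [0..<n]))"

text \<open>Block \<open>k + 1\<close> holds the inverse, ranging over all matrices since it may
  have negative entries. Block \<open>k + 2\<close> holds the identity, characterised as a left unit
  for all matrices.\<close>

definition invertible_fml :: "nat \<Rightarrow> nat \<Rightarrow> semiring_sym fml" where
  "invertible_fml n k = Neg (All_mat n (k + 1) (All_mat n (k + 2) (Neg (Conjs
     [All_mat n (k + 3) (mat_eq_fml n (sg_mult (Var (k + 2)) (Var (k + 3))) (Var (k + 3))),
      mat_eq_fml n (sg_mult (Var k) (Var (k + 1))) (Var (k + 2)),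
      mat_eq_fml n (sg_mult (Var (k + 1)) (Var k)) (Var (k + 2))]))))"

primrec mat_fml :: "nat \<Rightarrow> semigroup_sym fml \<Rightarrow> semiring_sym fml" where
  "mat_fml n (Eq s t) = mat_eq_fml n s t"
| "mat_fml n (Neg p) = Neg (mat_fml n p)"
| "mat_fml n (Conj p q) = Conj (mat_fml n p) (mat_fml n q)"
| "mat_fml n (All k p) =
     All_mat n k (Imp_fml (Conj (nonneg_fml n k) (invertible_fml n k)) (mat_fml n p))"

definition decode_mat :: "nat \<Rightarrow> (nat \<Rightarrow> 'a::ring_1) \<Rightarrow> nat \<Rightarrow> 'a mat" where
  "decode_mat n e k = mat n n (\<lambda>(i, j). e (mvar k i j 0) - e (mvar k i j 1))"

lemma sat_foldr_All:
  assumes "range e \<subseteq> universe M"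
  shows "sat M e (foldr All xs p) \<longleftrightarrow>
    (\<forall>e'. range e' \<subseteq> universe M \<and> (\<forall>y. y \<notin> set xs \<longrightarrow> e' y = e y) \<longrightarrow> sat M e' p)"
  using assms
proof (induction xs arbitrary: e)
  case Nil
  have "e' = e" if "\<forall>y. e' y = e y" for e' using that by auto
  then show ?case using Nil by auto
next
  case (Cons x xs)
  have "range (e(x := a)) \<subseteq> universe M" if "a \<in> universe M" for a
    using Cons.prems that by auto
  note IH = Cons.IH[OF this]
  have "(\<forall>a\<in>universe M. \<forall>e'. range e' \<subseteq> universe M \<and> (\<forall>y. y \<notin> set xs \<longrightarrow> e' y = (e(x := a)) y) \<longrightarrow> sat M e' p)
    \<longleftrightarrow> (\<forall>e'. range e' \<subseteq> universe M \<and> (\<forall>y. y \<notin> set (x # xs) \<longrightarrow> e' y = e y) \<longrightarrow> sat M e' p)" (is "?L \<longleftrightarrow> ?R")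
  proof
    assume L: ?L
    show ?R
    proof (intro allI impI, elim conjE)
      fix e' assume e': "range e' \<subseteq> universe M" "\<forall>y. y \<notin> set (x # xs) \<longrightarrow> e' y = e y"
      show "sat M e' p"
        by (rule L[rule_format, of "e' x"]) (use e' in auto)
    qed
  qed auto
  then show ?case using IH by (simp del: fun_upd_apply)
qed

section \<open>Correctness of the translation into the positive semiring\<close>

context
  fixes n :: nat and G :: "(semigroup_sym, 'a::{ring_1, linordered_ring_strict} mat) op_model"
    and S :: "(semiring_sym, 'a) op_model"
  assumes n0: "0 < n"
  defines "G \<equiv> nonneg_semigroup TYPE('a) n" and "S \<equiv> pos_semiring TYPE('a)"
begin

lemma S_oper: "oper S SrAdd = (+)" "oper S SrMult = (*)"
  by (simp_all add: S_def)

lemma eval_sum_trm: "eval_trm S e (sum_trm f l) = (\<Sum>k\<le>l. eval_trm S e (f k))"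
  by (induction l) (simp_all add: S_def)

lemma decode_mat_carrier: "decode_mat n e k \<in> carrier_mat n n"
  by (simp add: decode_mat_def)

lemma eval_carrier: "(\<And>k. E k \<in> carrier_mat n n) \<Longrightarrow> eval_trm G E t \<in> carrier_mat n n"
  by (induction t) (simp_all add: G_def oper_M)

lemma eval_entry_trm:
  assumes "i < n" "j < n"
  shows "eval_trm G (decode_mat n e) t $$ (i, j) =
    eval_trm S e (fst (entry_trm n t i j)) - eval_trm S e (snd (entry_trm n t i j))"
  using assms
proof (induction t arbitrary: i j)
  case (Var k)
  then show ?case by (simp add: decode_mat_def)
next
  case (App f s t)
  have n: "{..n - 1} = {..<n}" using n0 by auto
  have "eval_trm G (decode_mat n e) (App f s t) $$ (i, j) =
      (\<Sum>k<n. eval_trm G (decode_mat n e) s $$ (i, k) * eval_trm G (decode_mat n e) t $$ (k, j))"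
    using mult_entry[OF eval_carrier[OF decode_mat_carrier] eval_carrier[OF decode_mat_carrier] App.prems]
    by (simp add: G_def oper_M del: index_mult_mat)
  also have "\<dots> = (\<Sum>k<n.
      (eval_trm S e (fst (entry_trm n s i k)) - eval_trm S e (snd (entry_trm n s i k))) *
      (eval_trm S e (fst (entry_trm n t k j)) - eval_trm S e (snd (entry_trm n t k j))))"
    by (rule sum.cong) (use App in auto)
  also have "\<dots> = eval_trm S e (fst (entry_trm n (App f s t) i j)) - eval_trm S e (snd (entry_trm n (App f s t) i j))"
    by (simp add: eval_sum_trm n S_oper algebra_simps del: One_nat_def flip: sum_subtractf)
  finally show ?case .
qed

lemma sat_mat_eq_fml:
  "sat S e (mat_eq_fml n s t) \<longleftrightarrow> eval_trm G (decode_mat n e) s = eval_trm G (decode_mat n e) t"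
proof -
  have "eval_trm G (decode_mat n e) s = eval_trm G (decode_mat n e) t \<longleftrightarrow>
      (\<forall>i<n. \<forall>j<n. eval_trm G (decode_mat n e) s $$ (i, j) = eval_trm G (decode_mat n e) t $$ (i, j))"
    by (intro mat_eq_iff_entries eval_carrier decode_mat_carrier)
  also have "\<dots> \<longleftrightarrow> sat S e (mat_eq_fml n s t)"
    by (auto simp: mat_eq_fml_def eval_entry_trm S_def algebra_simps)
  finally show ?thesis by simp
qed

lemma set_mvars: "set (mvars n k) = {mvar k i j s | i j s. i < n \<and> j < n \<and> s < 2}"
  by (auto simp: mvars_def less_2_cases_iff)

text \<open>Every ring element is a difference of two positive ones, so the variables of block
  \<open>k\<close> run through all matrices. Assumption \<open>p\<close> says that satisfaction
  depends only on the decoded matrices, which allows nested use.\<close>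

lemma sat_All_mat:
  assumes p: "\<And>e. range e \<subseteq> {r. 0 < r} \<Longrightarrow> sat S e p \<longleftrightarrow> \<Phi> (decode_mat n e)"
    and e: "range e \<subseteq> {r. 0 < r}"
  shows "sat S e (All_mat n k p) \<longleftrightarrow> (\<forall>A\<in>carrier_mat n n. \<Phi> ((decode_mat n e)(k := A)))"
proof -
  have U: "universe S = {r. 0 < r}" by (simp add: S_def)
  have sat: "sat S e (All_mat n k p) \<longleftrightarrow> (\<forall>e'. range e' \<subseteq> {r. 0 < r} \<and>
      (\<forall>y. y \<notin> set (mvars n k) \<longrightarrow> e' y = e y) \<longrightarrow> \<Phi> (decode_mat n e'))"
    unfolding All_mat_def using sat_foldr_All[of e S] e p by (auto simp: U)
  have dec: "decode_mat n e' = (decode_mat n e)(k := decode_mat n e' k)"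
    if "\<forall>y. y \<notin> set (mvars n k) \<longrightarrow> e' y = e y" for e'
  proof
    fix l
    show "decode_mat n e' l = ((decode_mat n e)(k := decode_mat n e' k)) l"
      using that by (auto simp: decode_mat_def set_mvars)
  qed
  show ?thesis
    unfolding sat
  proof (intro iffI ballI allI impI)
    fix A :: "'a mat"
    assume L: "\<forall>e'. range e' \<subseteq> {r. 0 < r} \<and>
      (\<forall>y. y \<notin> set (mvars n k) \<longrightarrow> e' y = e y) \<longrightarrow> \<Phi> (decode_mat n e')" and A: "A \<in> carrier_mat n n"
    \<comment> \<open>A ring element is written as \<open>(a + 1) - 1\<close> if it is nonnegative
      and as \<open>1 - (1 - a)\<close> otherwise, so that both parts are positive.\<close>
    define part where "part s a = (if s = 0 then if 0 \<le> a then a + 1 else 1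
        else if 0 \<le> a then 1 else 1 - a)" for s :: nat and a :: 'a
    define e' where "e' y = (if y \<in> set (mvars n k)
        then case prod_decode y of (_, y') \<Rightarrow> case prod_decode y' of (i, y'') \<Rightarrow>
          case prod_decode y'' of (j, s) \<Rightarrow> part s (A $$ (i, j))
        else e y)" for y
    have part: "0 < part s a" "part 0 a - part (Suc 0) a = a" for s a
      using one_pos[where 'a='a] by (auto simp: part_def add_nonneg_pos intro: less_le_trans)
    have e'k: "e' (mvar k i j s) = part s (A $$ (i, j))" if "i < n" "j < n" "s < 2" for i j s
      using that unfolding e'_def set_mvars by (auto simp: mvar_def)
    have "0 < e' y" for y
      using e part(1) unfolding e'_def by (auto split: prod.split)
    moreover have e'e: "\<forall>y. y \<notin> set (mvars n k) \<longrightarrow> e' y = e y" by (simp add: e'_def)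
    ultimately have "\<Phi> (decode_mat n e')" using L by blast
    moreover have "decode_mat n e' k = A"
      using A by (subst mat_eq_iff_entries[of _ n]) (auto simp: decode_mat_def e'k part(2))
    ultimately show "\<Phi> ((decode_mat n e)(k := A))" using dec[OF e'e] by simp
  next
    fix e' :: "nat \<Rightarrow> 'a"
    assume "\<forall>A\<in>carrier_mat n n. \<Phi> ((decode_mat n e)(k := A))"
      and "range e' \<subseteq> {r. 0 < r} \<and> (\<forall>y. y \<notin> set (mvars n k) \<longrightarrow> e' y = e y)"
    then have "\<Phi> ((decode_mat n e)(k := decode_mat n e' k))" "decode_mat n e' = (decode_mat n e)(k := decode_mat n e' k)"
      using dec[of e'] decode_mat_carrier by blast+
    then show "\<Phi> (decode_mat n e')" by simp
  qed
qed

lemma sat_nonneg_fml: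
  "sat S e (nonneg_fml n k) \<longleftrightarrow> (\<forall>i<n. \<forall>j<n. 0 \<le> decode_mat n e k $$ (i, j))"
proof -
  have "(\<forall>a>0. y \<noteq> x + a) \<longleftrightarrow> 0 \<le> x - y" for x y :: 'a
  proof
    assume *: "\<forall>a>0. y \<noteq> x + a"
    show "0 \<le> x - y"
    proof (rule ccontr)
      assume "\<not> 0 \<le> x - y"
      then have "0 < y - x" by simp
      then show False using * by (metis add.commute diff_add_cancel)
    qed
  qed auto
  then show ?thesis
    by (auto simp: nonneg_fml_def S_def decode_mat_def)
qed

lemma left_unit_iff:
  assumes "(U :: 'a mat) \<in> carrier_mat n n"
  shows "(\<forall>A\<in>carrier_mat n n. U * A = A) \<longleftrightarrow> U = 1\<^sub>m n"
proof
  assume "\<forall>A\<in>carrier_mat n n. U * A = A"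
  then have "U * 1\<^sub>m n = 1\<^sub>m n" by simp
  then show "U = 1\<^sub>m n" using assms by simp
qed simp

lemma sat_invertible_fml:
  assumes "range e \<subseteq> {r. 0 < r}"
  shows "sat S e (invertible_fml n k) \<longleftrightarrow> invertible_mat (decode_mat n e k)"
proof -
  have GI: "oper G f = (*)" for f by (simp add: G_def oper_M)
  have 1: "sat S e (All_mat n (k + 3) (mat_eq_fml n (sg_mult (Var (k + 2)) (Var (k + 3))) (Var (k + 3)))) \<longleftrightarrow>
      decode_mat n e (k + 2) = 1\<^sub>m n" if "range e \<subseteq> {r. 0 < r}" for e
    using sat_All_mat[where \<Phi> = "\<lambda>E. E (k + 2) * E (k + 3) = E (k + 3)", OF _ that]
      left_unit_iff[OF decode_mat_carrier]
    by (simp add: sat_mat_eq_fml GI)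
  let ?\<Phi> = "\<lambda>E. \<not> (E (k + 2) = 1\<^sub>m n \<and> E k * E (k + 1) = E (k + 2) \<and> E (k + 1) * E k = E (k + 2))"
  have 2: "sat S e (All_mat n (k + 2) (Neg (Conjs
     [All_mat n (k + 3) (mat_eq_fml n (sg_mult (Var (k + 2)) (Var (k + 3))) (Var (k + 3))),
      mat_eq_fml n (sg_mult (Var k) (Var (k + 1))) (Var (k + 2)),
      mat_eq_fml n (sg_mult (Var (k + 1)) (Var k)) (Var (k + 2))])))
    \<longleftrightarrow> (\<forall>U\<in>carrier_mat n n. ?\<Phi> ((decode_mat n e)(k + 2 := U)))" if "range e \<subseteq> {r. 0 < r}" for e
    by (rule sat_All_mat[OF _ that])
      (simp only: sat.simps sat_Conjs list.set ball_simps 1 sat_mat_eq_fml eval_trm.simps GI simp_thms)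
  have "sat S e (invertible_fml n k) \<longleftrightarrow>
      \<not> (\<forall>B\<in>carrier_mat n n. \<forall>U\<in>carrier_mat n n. ?\<Phi> (((decode_mat n e)(k + 1 := B))(k + 2 := U)))"
    unfolding invertible_fml_def sat.simps
    by (subst sat_All_mat[where \<Phi> = "\<lambda>E. \<forall>U\<in>carrier_mat n n. ?\<Phi> (E(k + 2 := U))", OF 2 assms]) simp_all
  also have "\<dots> \<longleftrightarrow> (\<exists>B\<in>carrier_mat n n. decode_mat n e k * B = 1\<^sub>m n \<and> B * decode_mat n e k = 1\<^sub>m n)"
    by auto (metis one_carrier_mat)
  also have "\<dots> \<longleftrightarrow> invertible_mat (decode_mat n e k)"
    using invertible_matI[OF decode_mat_carrier] invertible_matE[OF _ decode_mat_carrier] by metis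
  finally show ?thesis .
qed

lemma sat_mat_fml:
  assumes "range e \<subseteq> {r. 0 < r}"
  shows "sat S e (mat_fml n p) \<longleftrightarrow> sat G (decode_mat n e) p"
  using assms
proof (induction p arbitrary: e)
  case (All k p)
  have "sat S e (mat_fml n (All k p)) \<longleftrightarrow> (\<forall>A\<in>carrier_mat n n.
      (\<forall>i<n. \<forall>j<n. 0 \<le> A $$ (i, j)) \<and> invertible_mat A \<longrightarrow> sat G ((decode_mat n e)(k := A)) p)"
    unfolding mat_fml.simps
    by (subst sat_All_mat[where \<Phi> = "\<lambda>E. (\<forall>i<n. \<forall>j<n. 0 \<le> E k $$ (i, j)) \<and> invertible_mat (E k) \<longrightarrow> sat G E p",
        OF _ All.prems]) (simp_all add: sat_nonneg_fml sat_invertible_fml All.IH)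
  then show ?case by (auto simp: G_def universe_M nonneg_mats_def)
qed (simp_all add: sat_mat_eq_fml)

text \<open>Decoded matrices need not lie in the universe of \<open>G\<close>, but the truth of a
  sentence does not depend on the assignment.\<close>

lemma true_in_mat_fml:
  assumes "sentence p"
  shows "true_in S (mat_fml n p) \<longleftrightarrow> true_in G p"
proof -
  have one: "1\<^sub>m n \<in> universe G"
    using one_pos[where 'a='a] invertible_matI[of "1\<^sub>m n :: 'a mat" n "1\<^sub>m n"]
    by (auto simp: G_def universe_M nonneg_mats_def less_imp_le)
  have *: "true_in G p \<longleftrightarrow> sat G E p" for E using sentence_true_in_iff[OF assms one] .
  have "sat S e (mat_fml n p) \<longleftrightarrow> true_in G p" if "range e \<subseteq> {r. 0 < r}" for e
    using sat_mat_fml[OF that] * by simp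
  moreover have "range (\<lambda>_::nat. 1::'a) \<subseteq> {r. 0 < r}" using one_pos by auto
  ultimately show ?thesis unfolding true_in_def[of S] by (auto simp: S_def)
qed

end

section \<open>Transfer of elementary equivalence in both directions\<close>

theorem theorem1:
  fixes n m :: nat
  assumes half_R: "\<exists>h::'a::{ring_1, linordered_ring_strict}. 2 * h = 1"
    and half_S: "\<exists>h::'b::{ring_1, linordered_ring_strict}. 2 * h = 1"
    and "n \<ge> 3" and "m \<ge> 3"
  shows "elementarily_equivalent (nonneg_semigroup TYPE('a) n) (nonneg_semigroup TYPE('b) m) \<longleftrightarrow>
    n = m \<and> elementarily_equivalent (pos_semiring TYPE('a)) (pos_semiring TYPE('b))"
proof -
  obtain h :: 'a where h: "2 * h = 1" using half_R by blast
  obtain h' :: 'b where h': "2 * h' = 1" using half_S by blast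
  interpret R: half_mats h n using h assms by unfold_locales
  interpret S: half_mats h' m using h' assms by unfold_locales
  show ?thesis
  proof
    assume E: "elementarily_equivalent (nonneg_semigroup TYPE('a) n) (nonneg_semigroup TYPE('b) m)"
    \<comment> \<open>A number \<open>k\<close> violating this would make
      \<open>Neg (roots_fml k)\<close> true in exactly one of the two semigroups.\<close>
    then have "k \<le> n * (n - 1) \<longleftrightarrow> k \<le> m * (m - 1)" for k
      using R.true_in_roots_fml[of k] S.true_in_roots_fml[of k]
      unfolding elementarily_equivalent_iff by blast
    then have eq: "n * (n - 1) = m * (m - 1)" by (metis order_antisym order_refl)
    have lt: "a * (a - 1) < b * (b - 1)" if "a < b" "3 \<le> a" for a b :: nat
      using that by (intro mult_strict_mono') auto
    have "n = m" using eq lt[of n m] lt[of m n] assms by (metis less_irrefl linorder_neqE_nat)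
    \<comment> \<open>The translations have free variables, so equivalence of the semigroups is used
      for all formulas, while that of the semirings is checked on sentences only.\<close>
    moreover have "elementarily_equivalent (pos_semiring TYPE('a)) (pos_semiring TYPE('b))"
      using E R.true_in_interp_fml S.true_in_interp_fml
      unfolding elementarily_equivalent_iff[of "nonneg_semigroup TYPE('a) n"]
      unfolding elementarily_equivalent_def by blast
    ultimately show "n = m \<and> elementarily_equivalent (pos_semiring TYPE('a)) (pos_semiring TYPE('b))"
      by blast
  next
    assume R: "n = m \<and> elementarily_equivalent (pos_semiring TYPE('a)) (pos_semiring TYPE('b))"
    have "0 < n" using assms by simp
    then show "elementarily_equivalent (nonneg_semigroup TYPE('a) n) (nonneg_semigroup TYPE('b) m)"
      using R true_in_mat_fml[where 'a='a] true_in_mat_fml[where 'a='b]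
      unfolding elementarily_equivalent_iff[of "pos_semiring TYPE('a)"]
      unfolding elementarily_equivalent_def by blast
  qed
qed

end
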